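(* Let $r\geq 3$ be an integer such that $r-2$ is a prime power, let $d>0$, and let $0<\beta<1$ be a constant. Then there is a constant $C=C(r,d)$, depending only on $r$ and $d$, such that for all sufficiently large $n$ the following holds: if $H$ is a connected graph on $n$ vertices with average degree at least $d$ and independence number $\alpha(H)\leq \beta n$, then \[ \widehat{R}(H;r) > \frac{nd}{2}(r-2)^2 - C\sqrt{n}. \]
   Context: For a graph $H$ and a positive integer $r$, the size Ramsey number $\widehat{R}(H;r)$ is the minimum integer $m$ such that there exists a graph $G$ with $m$ edges such that every coloring of the edges of $G$ with $r$ colors contains a monochromatic copy of $H$. The average degree of a graph $H$ on $n$ vertices is $2|E(H)|/n$. The independence number $\alpha(H)$ is the maximum size of a set of pairwise non-adjacent vertices of $H$. *)

theory Defs
  imports Complex_Main "HOL-Library.Ramsey" "HOL-Number_Theory.Prime_Powers"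
begin

text \<open>
  A graph is given by its vertex set and its set of edges, each edge being a two-element
  set of vertices, as in \<^theory>\<open>HOL-Library.Ramsey\<close>; independence of a set of vertices is
  \<^const>\<open>indep\<close> from that theory.
\<close>

definition fin_graph :: "'a set \<Rightarrow> 'a set set \<Rightarrow> bool" where
  "fin_graph V E \<longleftrightarrow> finite V \<and> E \<subseteq> [V]\<^bsup>2\<^esup>"

definition connected_graph :: "'a set \<Rightarrow> 'a set set \<Rightarrow> bool" where
  "connected_graph V E \<longleftrightarrow> V \<noteq> {} \<and> (\<forall>u\<in>V. \<forall>v\<in>V. (u, v) \<in> {(x, y). {x, y} \<in> E}\<^sup>*)"

definition average_degree :: "'a set \<Rightarrow> 'a set set \<Rightarrow> real" where
  "average_degree V E = 2 * real (card E) / real (card V)"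

definition independence_number :: "'a set \<Rightarrow> 'a set set \<Rightarrow> nat" where
  "independence_number V E = Max {card S | S. S \<subseteq> V \<and> indep S E}"

text \<open>A copy of \<open>(V, E)\<close> in \<open>(W, F)\<close> is a not necessarily induced subgraph, given by an
  injective edge-preserving map \<open>f\<close>.\<close>

definition mono_copy ::
  "'a set \<Rightarrow> 'a set set \<Rightarrow> 'b set \<Rightarrow> 'b set set \<Rightarrow> ('b set \<Rightarrow> nat) \<Rightarrow> bool" where
  "mono_copy V E W F c \<longleftrightarrow>
     (\<exists>f i. inj_on f V \<and> f ` V \<subseteq> W \<and> (\<forall>e\<in>E. f ` e \<in> F \<and> c (f ` e) = i))"

definition arrows :: "'b set \<Rightarrow> 'b set set \<Rightarrow> nat \<Rightarrow> 'a set \<Rightarrow> 'a set set \<Rightarrow> bool" where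
  "arrows W F r V E \<longleftrightarrow> (\<forall>c \<in> F \<rightarrow> {..<r}. mono_copy V E W F c)"

text \<open>Every finite graph is isomorphic to one whose vertices are natural numbers, so it
  suffices to let the host graph range over these.\<close>

definition size_ramsey :: "'a set \<Rightarrow> 'a set set \<Rightarrow> nat \<Rightarrow> nat" where
  "size_ramsey V E r =
     (LEAST m. \<exists>(W :: nat set) F. fin_graph W F \<and> card F = m \<and> arrows W F r V E)"

text \<open>By Ramsey's theorem, the minimum in the definition of \<^const>\<open>size_ramsey\<close> is attained.\<close>

lemma arrows_exists:
  assumes "fin_graph V E"
  shows "\<exists>(W :: nat set) F. fin_graph W F \<and> arrows W F r V E"
proof -
  obtain N :: nat where N: "partn_lst {..<N} (replicate r (card V + 2)) 2"
    using ramsey_full by blast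
  let ?F = "[{..<N}]\<^bsup>2\<^esup>"
  have "mono_copy V E {..<N} ?F c" if c: "c \<in> ?F \<rightarrow> {..<r}" for c
  proof -
    obtain i H where i: "i < r" and H: "H \<in> [{..<N}]\<^bsup>(card V + 2)\<^esup>"
      and mono: "c ` [H]\<^bsup>2\<^esup> \<subseteq> {i}"
      using partn_lstE[OF N c length_replicate] by (metis length_replicate nth_replicate)
    have H': "H \<subseteq> {..<N}" "finite H" "card V \<le> card H"
      using H by (auto simp: nsets_def)
    have "finite V" and E: "E \<subseteq> [V]\<^bsup>2\<^esup>"
      using assms by (auto simp: fin_graph_def)
    then obtain f where f: "inj_on f V" "f ` V \<subseteq> H"
      using H' card_le_inj by metis
    have "f ` e \<in> [H]\<^bsup>2\<^esup>" if "e \<in> E" for e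
      using that E f by (auto simp: nsets_def card_image inj_on_subset)
    moreover have "[H]\<^bsup>2\<^esup> \<subseteq> ?F"
      using H' by (intro nsets_mono)
    ultimately show ?thesis
      unfolding mono_copy_def using f H' mono by (intro exI[of _ f] exI[of _ i]) blast
  qed
  then show ?thesis
    unfolding arrows_def fin_graph_def by (intro exI[of _ "{..<N}"] exI[of _ ?F]) auto
qed

end

theory Submission
  imports Defs "HOL-Computational_Algebra.Polynomial_Factorial"
begin

text \<open>
  Write \<open>q = r - 2\<close> and suppose that the host graph \<open>G\<close> has at most \<open>q\<^sup>2 n d / 2\<close> edges. The edges at
  vertices of large constant degree get a colour of their own; there are few such vertices, so a
  copy of \<open>H\<close> in this colour would have an independent set of more than \<open>\<beta> n\<close> vertices. The other
  vertices are distributed over the points of an affine plane of order \<open>q\<close>, and an edge joining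
  two different points gets as its colour the parallel class of the line through them. A
  connected subgraph in such a colour lives over a single line, which spans a \<open>1/q\<^sup>2\<close> fraction of
  the pairs of points. Giving the edges inside different points different colours lowers this to
  \<open>(q\<^sup>2 - 1)/q\<^sup>4\<close>, and the linear amount gained absorbs the deviation of order \<open>\<surd>n\<close> in a second
  moment argument, so that in the end \<open>C = 1\<close> suffices.

  A field of order \<open>q = p\<^sup>k\<close> is found in a quotient of \<open>\<int>[x]\<close> by a maximal ideal that contains \<open>p\<close> and
  an irreducible factor of \<open>x\<^sup>q\<^sup>-\<^sup>1 - 1\<close> vanishing at a primitive complex root of unity: there
  \<open>x\<close> has order exactly \<open>q - 1\<close>, and \<open>0\<close> together with the powers of \<open>x\<close> are the roots of
  \<open>z\<^sup>q - z\<close>.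
\<close>

subsection \<open>Maximal ideals and finite fields\<close>

definition is_ideal :: "'a::comm_ring_1 set \<Rightarrow> bool" where
  "is_ideal M \<longleftrightarrow> 0 \<in> M \<and> (\<forall>a\<in>M. \<forall>b\<in>M. a + b \<in> M) \<and> (\<forall>a\<in>M. \<forall>c. c * a \<in> M)"

text \<open>Zorn's lemma applies because the union of a chain of ideals avoiding \<open>1\<close> is
  again one. For \<open>a\<close> outside the maximal \<open>M\<close>, the ideal
  \<open>M + (a)\<close> is strictly larger and so contains \<open>1\<close>; this yields an inverse
  of \<open>a\<close> modulo \<open>M\<close>.\<close>

lemma exists_maximal_ideal:
  fixes I :: "'a::comm_ring_1 set"
  assumes "is_ideal I" "1 \<notin> I"
  shows "\<exists>M. is_ideal M \<and> I \<subseteq> M \<and> 1 \<notin> M \<and> (\<forall>a. a \<notin> M \<longrightarrow> (\<exists>b. a * b - 1 \<in> M))"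
proof -
  let ?A = "{M. is_ideal M \<and> I \<subseteq> M \<and> 1 \<notin> M}"
  have "\<Union>C \<in> ?A" if ne: "C \<noteq> {}" and chain: "subset.chain ?A C" for C
  proof -
    have C: "\<And>X. X \<in> C \<Longrightarrow> is_ideal X \<and> I \<subseteq> X \<and> 1 \<notin> X"
      and ch: "\<And>X Y. X \<in> C \<Longrightarrow> Y \<in> C \<Longrightarrow> X \<subseteq> Y \<or> Y \<subseteq> X"
      using chain unfolding subset_chain_def by auto
    obtain X where X: "X \<in> C" using ne by blast
    have "0 \<in> \<Union>C" using X C is_ideal_def by blast
    moreover have "a + b \<in> \<Union>C" if ab: "a \<in> \<Union>C" "b \<in> \<Union>C" for a b
    proof -
      obtain X Y where XY: "X \<in> C" "Y \<in> C" "a \<in> X" "b \<in> Y" using ab by blast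
      then obtain Z where "Z \<in> C" "a \<in> Z" "b \<in> Z" using ch[of X Y] by blast
      then show ?thesis using C[of Z] unfolding is_ideal_def by blast
    qed
    moreover have "c * a \<in> \<Union>C" if "a \<in> \<Union>C" for a c
      using that C unfolding is_ideal_def by blast
    ultimately have "is_ideal (\<Union>C)" unfolding is_ideal_def by blast
    then show ?thesis using X C by blast
  qed
  moreover have "?A \<noteq> {}" using assms by blast
  ultimately have "\<exists>M\<in>?A. \<forall>X\<in>?A. M \<subseteq> X \<longrightarrow> X = M"
    by (intro subset_Zorn_nonempty)
  then obtain M where M: "M \<in> ?A" and max: "\<forall>X\<in>?A. M \<subseteq> X \<longrightarrow> X = M"
    by (elim bexE)
  have "\<exists>b. a * b - 1 \<in> M" if "a \<notin> M" for a
  proof -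
    let ?X = "{m + a * b |m b. m \<in> M}"
    have M': "is_ideal M" using M by blast
    have "is_ideal ?X"
      unfolding is_ideal_def
    proof (intro conjI ballI allI)
      have "0 = 0 + a * 0" "0 \<in> M" using M' by (auto simp: is_ideal_def)
      then show "0 \<in> ?X" by blast
    next
      fix x y assume "x \<in> ?X" "y \<in> ?X"
      then obtain m b n c where "x = m + a * b" "y = n + a * c" "m \<in> M" "n \<in> M" by blast
      then have "x + y = (m + n) + a * (b + c)" "m + n \<in> M"
        using M' by (auto simp: algebra_simps is_ideal_def)
      then show "x + y \<in> ?X" by blast
    next
      fix x c assume "x \<in> ?X"
      then obtain m b where "x = m + a * b" "m \<in> M" by blast
      then have "c * x = c * m + a * (c * b)" "c * m \<in> M"
        using M' by (auto simp: algebra_simps is_ideal_def)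
      then show "c * x \<in> ?X" by blast
    qed
    moreover have sub: "M \<subseteq> ?X"
    proof
      fix m assume "m \<in> M"
      then show "m \<in> ?X" by (intro CollectI exI[of _ m] exI[of _ 0]) simp
    qed
    moreover have "a \<in> ?X" using M' by (intro CollectI exI[of _ 0] exI[of _ 1]) (simp add: is_ideal_def)
    ultimately have "?X \<noteq> M" "is_ideal ?X" "M \<subseteq> ?X" using that by auto
    then have "1 \<in> ?X" using bspec[OF max, of ?X] M by auto
    then obtain m b where "1 = m + a * b" "m \<in> M" by blast
    then have "a * b - 1 = (-1) * m" by (simp add: algebra_simps)
    with \<open>m \<in> M\<close> M' show ?thesis unfolding is_ideal_def by metis
  qed
  with M show ?thesis by blast
qed

text \<open>The quotient field is never formed as a type: its elements are represented by ring
  elements up to the congruence \<open>eqv\<close>, and \<open>inv\<close> says that nonzero classes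
  are invertible.\<close>

locale max_ideal =
  fixes M :: "'a::comm_ring_1 set"
  assumes ideal: "is_ideal M" and one: "1 \<notin> M"
    and inv: "\<And>a. a \<notin> M \<Longrightarrow> \<exists>b. a * b - 1 \<in> M"
begin

lemma zero_mem: "0 \<in> M" and add_mem: "a \<in> M \<Longrightarrow> b \<in> M \<Longrightarrow> a + b \<in> M"
  and mult_mem: "a \<in> M \<Longrightarrow> c * a \<in> M"
  using ideal by (auto simp: is_ideal_def)

lemma mult_mem': "a \<in> M \<Longrightarrow> a * c \<in> M"
  using mult_mem[of a c] by (simp add: mult.commute)

lemma uminus_mem: "a \<in> M \<Longrightarrow> - a \<in> M"
  using mult_mem[of a "-1"] by simp

lemma diff_mem: "a \<in> M \<Longrightarrow> b \<in> M \<Longrightarrow> a - b \<in> M"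
  using add_mem[of a "- b"] uminus_mem[of b] by simp

lemma prime: assumes "a * b \<in> M" shows "a \<in> M \<or> b \<in> M"
proof (rule ccontr)
  assume "\<not> ?thesis"
  then obtain c where c: "a * c - 1 \<in> M" and b: "b \<notin> M" using inv by blast
  have "b = c * (a * b) - b * (a * c - 1)" by (simp add: algebra_simps)
  then have "b \<in> M" using diff_mem[OF mult_mem[OF assms] mult_mem[OF c]] by metis
  with b show False by simp
qed

definition eqv (infix "\<sim>" 50) where "a \<sim> b \<longleftrightarrow> a - b \<in> M"

lemma eqv_refl [simp]: "a \<sim> a" by (simp add: eqv_def zero_mem)
lemma eqv_sym: "a \<sim> b \<Longrightarrow> b \<sim> a" using uminus_mem[of "a - b"] by (simp add: eqv_def)
lemma eqv_trans [trans]: "a \<sim> b \<Longrightarrow> b \<sim> c \<Longrightarrow> a \<sim> c"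
  using add_mem[of "a - b" "b - c"] by (simp add: eqv_def)
lemma eqv_add: "a \<sim> b \<Longrightarrow> c \<sim> d \<Longrightarrow> a + c \<sim> b + d"
  using add_mem[of "a - b" "c - d"] by (simp add: eqv_def algebra_simps)
lemma eqv_diff: "a \<sim> b \<Longrightarrow> c \<sim> d \<Longrightarrow> a - c \<sim> b - d"
  using diff_mem[of "a - b" "c - d"] by (simp add: eqv_def algebra_simps)
lemma eqv_mult: assumes "a \<sim> b" "c \<sim> d" shows "a * c \<sim> b * d"
proof -
  have "a * c - b * d = c * (a - b) + b * (c - d)" by (simp add: algebra_simps)
  then show ?thesis
    using assms add_mem[OF mult_mem mult_mem, of "a - b" "c - d" c b] by (simp add: eqv_def)
qed
lemma eqv_power: "a \<sim> b \<Longrightarrow> a ^ n \<sim> b ^ n"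
  by (induction n) (auto intro: eqv_mult)
lemma eqv_cancel: "c * a \<sim> c * b \<Longrightarrow> \<not> c \<sim> 0 \<Longrightarrow> a \<sim> b"
  using prime[of c "a - b"] by (simp add: eqv_def algebra_simps)
lemma eqv_0_iff: "a \<sim> 0 \<longleftrightarrow> a \<in> M"
  by (simp add: eqv_def)

lemma power_eqv_0: "a ^ n \<sim> 0 \<Longrightarrow> a \<sim> 0"
proof (induction n)
  case 0
  then show ?case using one by (simp add: eqv_def)
next
  case (Suc n)
  then show ?case using prime[of a "a ^ n"] by (auto simp: eqv_def)
qed

text \<open>A polynomial over the quotient field has no more roots than its degree; polynomials over
  the ring itself stand in for those over the quotient.\<close>

lemma card_roots_le_degree:
  fixes f :: "'a poly"
  assumes "coeff f n \<notin> M" "degree f \<le> n" "finite A"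
    and "\<And>a. a \<in> A \<Longrightarrow> poly f a \<in> M" and "\<And>a b. a \<in> A \<Longrightarrow> b \<in> A \<Longrightarrow> a \<sim> b \<Longrightarrow> a = b"
  shows "card A \<le> n"
  using assms
proof (induction n arbitrary: f A)
  case 0
  then obtain c where c: "f = [:c:]" by (metis degree_eq_zeroE le_zero_eq)
  with 0 have "A = {}" by auto
  then show ?case by simp
next
  case (Suc n)
  show ?case
  proof (cases "A = {}")
    case False
    then obtain a where a: "a \<in> A" by blast
    \<comment> \<open>Division by \<open>X - a\<close>: the quotient \<open>g\<close> inherits the
      top coefficient of \<open>f\<close>, which stays outside \<open>M\<close>, and by primality
      every other root of \<open>f\<close> modulo \<open>M\<close> is a root of
      \<open>g\<close>.\<close>
    define g where "g = synthetic_div f a"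
    have f: "f + smult a g = pCons (poly f a) g"
      using synthetic_div_correct g_def by blast
    have dg: "degree g \<le> n"
      using Suc.prems(2) by (simp add: g_def degree_synthetic_div)
    have "coeff f (Suc n) = coeff g n"
      using arg_cong[OF f, of "\<lambda>h. coeff h (Suc n)"] dg by (simp add: coeff_eq_0)
    then have "coeff g n \<notin> M" using Suc.prems(1) by simp
    moreover have "poly g b \<in> M" if b: "b \<in> A - {a}" for b
    proof -
      have "poly f b - poly f a = (b - a) * poly g b"
        using arg_cong[OF f, of "\<lambda>h. poly h b"] by (simp add: algebra_simps)
      moreover have "poly f b - poly f a \<in> M" using Suc.prems(4) a b diff_mem by blast
      ultimately show ?thesis
        using prime[of "b - a" "poly g b"] Suc.prems(5)[of b a] a b by (auto simp: eqv_def)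
    qed
    ultimately have "card (A - {a}) \<le> n"
      using Suc.prems(3,5) dg by (intro Suc.IH[of g]) auto
    then show ?thesis using a Suc.prems(3) by simp
  qed simp
qed

text \<open>The inner binomial coefficients are divisible by \<open>p\<close>, which is zero modulo
  \<open>M\<close>.\<close>

lemma eqv_freshmans_dream:
  assumes p: "Factorial_Ring.prime (p::nat)" "of_nat p \<in> M"
  shows "(a + b) ^ p \<sim> a ^ p + b ^ p"
proof -
  have "(a + b) ^ p = (\<Sum>k\<le>p. of_nat (p choose k) * a ^ k * b ^ (p - k))"
    by (rule binomial_ring)
  also have "\<dots> = (\<Sum>k\<in>{..p} - {0, p}. of_nat (p choose k) * a ^ k * b ^ (p - k)) + (b ^ p + a ^ p)"
    using p prime_gt_0_nat[of p] by (subst sum.subset_diff[of "{0,p}"]) auto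
  finally have *: "(a + b) ^ p = (\<Sum>k\<in>{..p} - {0, p}. of_nat (p choose k) * a ^ k * b ^ (p - k)) + (b ^ p + a ^ p)" .
  \<comment> \<open>Stated for all subsets \<open>X\<close> of the inner indices so that induction
    over finite sets applies.\<close>
  have "(\<Sum>k\<in>X. of_nat (p choose k) * a ^ k * b ^ (p - k)) \<in> M" if "X \<subseteq> {..p} - {0, p}" for X
  proof -
    have "finite X" using that finite_subset by blast
    then show ?thesis using that
    proof (induction X)
      case (insert k X)
      have "p dvd (p choose k)" using insert.prems p by (intro dvd_choose_prime) auto
      then have "of_nat (p choose k) \<in> M" using p(2) by (metis dvd_def of_nat_mult mult_mem')
      then show ?case using insert by (simp add: add_mem mult_mem')
    qed (simp add: zero_mem)
  qed
  then show ?thesis using * by (simp add: eqv_def algebra_simps)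
qed

text \<open>Applying the sum version to \<open>(a - b) + b\<close> avoids the sign
  \<open>(-1) ^ p\<close> and with it a special case for \<open>p = 2\<close>.\<close>

lemma eqv_freshmans_dream_diff:
  assumes p: "Factorial_Ring.prime (p::nat)" "of_nat p \<in> M"
  shows "(a - b) ^ (p ^ k) \<sim> a ^ (p ^ k) - b ^ (p ^ k)"
proof -
  have 1: "(a - b) ^ p \<sim> a ^ p - b ^ p" for a b
    using eqv_diff[OF eqv_freshmans_dream[OF p, of "a - b" b] eqv_refl[of "b ^ p"]] 
    by (simp add: eqv_sym)
  show ?thesis
  proof (induction k)
    case (Suc k)
    have "(a - b) ^ (p ^ Suc k) = ((a - b) ^ (p ^ k)) ^ p" by (simp add: power_mult mult.commute flip: power_mult)
    also have "\<dots> \<sim> (a ^ (p ^ k) - b ^ (p ^ k)) ^ p" by (intro eqv_power Suc)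
    also have "\<dots> \<sim> (a ^ (p ^ k)) ^ p - (b ^ (p ^ k)) ^ p" by (rule 1)
    also have "\<dots> = a ^ (p ^ Suc k) - b ^ (p ^ Suc k)" by (simp add: mult.commute flip: power_mult)
    finally show ?case .
  qed simp
qed

end

section \<open>Integer polynomials and a primitive root of unity modulo a maximal ideal\<close>

lemma poly_of_int_mult:
  "poly (map_poly of_int (f * g)) z = poly (map_poly of_int f) z * (poly (map_poly of_int g) z :: 'a::{comm_ring_1,ring_char_0})"
proof -
  have add: "map_poly of_int (f + g) = (map_poly of_int f + map_poly of_int g :: 'a poly)" for f g
    by (intro poly_eqI) (simp add: coeff_map_poly)
  have smult: "map_poly of_int (smult c g) = (smult (of_int c) (map_poly of_int g) :: 'a poly)" for c g
    by (intro poly_eqI) (simp add: coeff_map_poly)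
  show ?thesis
    by (induction f) (simp_all add: map_poly_pCons add smult algebra_simps)
qed

lemma poly_of_int_prod_mset:
  "poly (map_poly of_int (prod_mset A)) z =
    (\<Prod>f\<in>#A. poly (map_poly of_int f) z :: 'a::{comm_ring_1,ring_char_0})"
  by (induction A) (simp_all add: poly_of_int_mult)

lemma cis_power_neq_1:
  assumes "0 < i" "i < N"
  shows "cis (2 * pi / real N) ^ i \<noteq> 1"
proof
  assume *: "cis (2 * pi / real N) ^ i = 1"
  have "inj_on (\<lambda>k. cis (2 * pi * real k / real N)) {..<N}"
    using bij_betw_roots_unity[of N] assms by (auto simp: bij_betw_def)
  moreover have "cis (2 * pi * real i / real N) = cis (2 * pi * real 0 / real N)"
    using * by (simp add: DeMoivre mult.commute)
  ultimately have "i = 0" using assms by (elim inj_onD) auto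
  with assms show False by simp
qed

text \<open>Modulo \<open>p\<close> the polynomial \<open>\<mu>\<close> keeps its positive degree,
  because its leading coefficient is a unit, so no multiple of it becomes the constant
  \<open>1\<close>. Hence \<open>\<mu>\<close> and \<open>p\<close> generate a proper ideal.\<close>

lemma not_in_ideal_of_prime_and_monic:
  fixes \<mu> :: "int poly"
  assumes "is_unit (lead_coeff \<mu>)" "degree \<mu> > 0" "prime (p :: nat)"
  shows "\<mu> * a + of_nat p * b \<noteq> 1"
proof
  assume eq: "\<mu> * a + of_nat p * b = 1"
  have p1: "\<not> int p dvd 1" using assms(3) by (simp add: prime_nat_iff)
  have pc: "coeff (of_nat p * b) n = int p * coeff b n" for n
    by (simp add: of_nat_poly)
  have co: "coeff (\<mu> * a) n = coeff 1 n - int p * coeff b n" for n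
    using arg_cong[OF eq, of "\<lambda>h. coeff h n"] pc[of n] by simp
  let ?B = "{m. \<not> int p dvd coeff a m}"
  have fin: "finite ?B"
    by (rule finite_subset[of _ "{..degree a}"]) (auto intro!: le_degree)
  have "?B \<noteq> {}"
  proof
    assume "?B = {}"
    then have "int p dvd coeff (\<mu> * a) 0" by (auto simp: coeff_mult)
    then have "int p dvd coeff (\<mu> * a) 0 + int p * coeff b 0" by simp
    then show False using p1 co[of 0] by simp
  qed
  \<comment> \<open>\<open>m\<close> is the degree of \<open>a\<close> modulo \<open>p\<close>; at
    index \<open>degree \<mu> + m\<close> only the product of the two leading terms survives modulo
    \<open>p\<close>.\<close>
  define m where "m = Max ?B"
  have m: "\<not> int p dvd coeff a m" and max: "\<And>j. j > m \<Longrightarrow> int p dvd coeff a j"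
    using Max_in[OF fin \<open>?B \<noteq> {}\<close>] Max_ge[OF fin] leD unfolding m_def by blast+
  let ?n = "degree \<mu> + m"
  have "int p dvd coeff \<mu> i * coeff a (?n - i)" if "i \<in> {..?n} - {degree \<mu>}" for i
    using that max[of "?n - i"] by (cases "i < degree \<mu>") (auto simp: coeff_eq_0)
  then have "int p dvd (\<Sum>i\<in>{..?n} - {degree \<mu>}. coeff \<mu> i * coeff a (?n - i))"
    by (rule dvd_sum)
  moreover have "coeff (\<mu> * a) ?n = lead_coeff \<mu> * coeff a m
      + (\<Sum>i\<in>{..?n} - {degree \<mu>}. coeff \<mu> i * coeff a (?n - i))"
    by (simp add: coeff_mult sum.remove[of "{..?n}" "degree \<mu>"])
  moreover have "int p dvd coeff (\<mu> * a) ?n"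
    using co[of ?n] assms(2) by simp
  ultimately have "int p dvd lead_coeff \<mu> * coeff a m"
    by (simp add: dvd_add_left_iff)
  then show False
    using m assms(1) by (simp add: dvd_mult_unit_iff')
qed

context max_ideal
begin

text \<open>\<open>e\<close> is the multiplicative order of \<open>x\<close> modulo
  \<open>M\<close>. It divides \<open>N\<close>, and the powers of \<open>x ^ e\<close> are
  congruent to \<open>1\<close>, so the cofactor of \<open>x ^ e - 1\<close> in
  \<open>x ^ N - 1\<close> reduces to the integer \<open>c = N / e\<close>.\<close>

lemma power_order_geometric:
  assumes "x ^ i \<sim> 1" "0 < i" "x ^ N \<sim> 1"
  obtains e c where "0 < e" "e \<le> i" "N = e * c" "(\<Sum>j<c. (x ^ e) ^ j) \<sim> of_nat c"
proof -
  define e where "e = (LEAST e. 0 < e \<and> x ^ e \<sim> 1)"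
  have e: "0 < e" "x ^ e \<sim> 1" "e \<le> i"
    using LeastI[of "\<lambda>e. 0 < e \<and> x ^ e \<sim> 1" i] Least_le[of "\<lambda>e. 0 < e \<and> x ^ e \<sim> 1" i] assms
    by (auto simp: e_def)
  have emin: "e \<le> j" if "0 < j" "x ^ j \<sim> 1" for j
    unfolding e_def by (rule Least_le) (use that in simp)
  have "x ^ N = (x ^ e) ^ (N div e) * x ^ (N mod e)"
    by (simp flip: power_mult power_add)
  also have "\<dots> \<sim> 1 ^ (N div e) * x ^ (N mod e)" by (intro eqv_mult eqv_power e) simp
  finally have "x ^ N \<sim> x ^ (N mod e)" by simp
  then have "x ^ (N mod e) \<sim> 1" using assms(3) eqv_sym eqv_trans by blast
  then have "N mod e = 0" using emin[of "N mod e"] e mod_less_divisor[of e N] by linarith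
  then obtain c where c: "N = e * c" by (elim dvdE[OF mod_0_imp_dvd])
  have "(\<Sum>j<m. (x ^ e) ^ j) \<sim> of_nat m" for m
  proof (induction m)
    case (Suc m)
    have "(x ^ e) ^ m \<sim> 1" using eqv_power[OF e(2), of m] by simp
    from eqv_add[OF Suc this] show ?case by (simp add: add.commute)
  qed simp
  then show thesis using that e c by blast
qed

end

text \<open>If \<open>x\<close> had order \<open>e < N\<close> modulo \<open>M\<close>, then
  \<open>x ^ N - 1 = (x ^ e - 1) * \<Psi>\<close>, and the prime \<open>\<mu>\<close> divides one
  factor. It is not the first, as \<open>\<zeta>\<close> has exact order \<open>N\<close>, so
  \<open>\<Psi>\<close> lies in \<open>M\<close>. But \<open>\<Psi>\<close> is congruent to
  \<open>c = N / e\<close>, a divisor of \<open>p ^ k - 1\<close> and thus coprime to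
  \<open>p\<close>, which puts \<open>1\<close> into \<open>M\<close>.\<close>

lemma exists_primitive_root_ideal:
  assumes p: "prime (p :: nat)" and N: "N = p ^ k - 1" "k > 0"
  obtains M :: "int poly set" and x where "max_ideal M" "of_nat p \<in> M" "x ^ N - 1 \<in> M"
    "\<And>i. 0 < i \<Longrightarrow> i < N \<Longrightarrow> x ^ i - 1 \<notin> M"
proof -
  define x :: "int poly" where "x = monom 1 1"
  define \<zeta> where "\<zeta> = cis (2 * pi / real N)"
  define ev where "ev = (\<lambda>f :: int poly. poly (map_poly of_int f) \<zeta>)"
  have "p ^ k > 1" using p N by (metis one_less_power prime_gt_1_nat)
  then have N0: "N > 0" using N by simp
  have xn: "x ^ n - 1 = monom 1 n - 1" for n by (simp add: x_def monom_power)
  have ev: "ev (x ^ n - 1) = \<zeta> ^ n - 1" for n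
  proof -
    have "map_poly of_int (monom 1 n - 1 :: int poly) = (monom 1 n - 1 :: complex poly)"
      by (intro poly_eqI) (auto simp: coeff_map_poly)
    then show ?thesis by (simp add: ev_def xn poly_monom)
  qed
  have "\<zeta> ^ N = 1" using N0 by (simp add: \<zeta>_def DeMoivre)
  have deg: "degree (x ^ N - 1) = N" 
    unfolding xn using N0
    by (intro antisym degree_diff_le le_degree) (auto simp: degree_monom_eq)
  then have nz: "x ^ N - 1 \<noteq> 0" using N0 by auto
  \<comment> \<open>The factorization recovers \<open>x ^ N - 1\<close> only up to a unit;
    divisibility in one direction already makes the product vanish at
    \<open>\<zeta>\<close>.\<close>
  have "normalize (prod_mset (prime_factorization (x ^ N - 1))) = normalize (x ^ N - 1)"
    using nz by (rule prod_mset_prime_factorization_weak)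
  then have "x ^ N - 1 dvd prod_mset (prime_factorization (x ^ N - 1))"
    by (rule associatedD2)
  then obtain c where "prod_mset (prime_factorization (x ^ N - 1)) = (x ^ N - 1) * c"
    by (elim dvdE)
  then have "ev (prod_mset (prime_factorization (x ^ N - 1))) = 0"
    using ev[of N] \<open>\<zeta> ^ N = 1\<close> by (simp add: ev_def poly_of_int_mult)
  then obtain \<mu> where \<mu>: "\<mu> \<in> prime_factors (x ^ N - 1)" "ev \<mu> = 0"
    by (auto simp: ev_def poly_of_int_prod_mset prod_mset_zero_iff)
  then have pr: "prime_elem \<mu>" and dv: "\<mu> dvd x ^ N - 1"
    by (auto simp: in_prime_factors_iff)
  have "lead_coeff (x ^ N - 1) = 1"
    unfolding deg using N0 by (simp add: xn)
  moreover obtain \<nu> where "x ^ N - 1 = \<mu> * \<nu>" using dv by (elim dvdE)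
  ultimately have "lead_coeff \<mu> * lead_coeff \<nu> = 1"
    by (metis lead_coeff_mult)
  then have lc: "is_unit (lead_coeff \<mu>)" by (metis dvdI)
  have dpos: "degree \<mu> > 0"
  proof (rule ccontr)
    assume "\<not> ?thesis"
    then obtain c where "\<mu> = [:c:]" by (metis degree_eq_zeroE gr0I)
    with lc have "is_unit \<mu>" by (simp add: is_unit_const_poly_iff)
    with pr show False by (simp add: prime_elem_def)
  qed
  define I where "I = {\<mu> * a + of_nat p * b |a b. True}"
  have idI: "is_ideal I"
    unfolding is_ideal_def
  proof (intro conjI ballI allI)
    show "0 \<in> I" unfolding I_def by (intro CollectI exI[of _ 0]) simp
  next
    fix u v assume "u \<in> I" "v \<in> I"
    then obtain a b c d where "u = \<mu> * a + of_nat p * b" "v = \<mu> * c + of_nat p * d"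
      by (auto simp: I_def)
    then have "u + v = \<mu> * (a + c) + of_nat p * (b + d)" by (simp add: algebra_simps)
    then show "u + v \<in> I" unfolding I_def by blast
  next
    fix u c assume "u \<in> I"
    then obtain a b where "u = \<mu> * a + of_nat p * b" by (auto simp: I_def)
    then have "c * u = \<mu> * (c * a) + of_nat p * (c * b)" by (simp add: algebra_simps)
    then show "c * u \<in> I" unfolding I_def by blast
  qed
  have "1 \<notin> I" unfolding I_def using not_in_ideal_of_prime_and_monic[OF lc dpos p] by auto
  with idI obtain M where "is_ideal M" "I \<subseteq> M" "1 \<notin> M" "\<And>a. a \<notin> M \<Longrightarrow> \<exists>b. a * b - 1 \<in> M"
    using exists_maximal_ideal by metis
  then have M: "max_ideal M" by (auto simp: max_ideal_def)
  interpret max_ideal M by (rule M)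
  have "\<mu> * 1 + of_nat p * 0 \<in> I" "\<mu> * 0 + of_nat p * 1 \<in> I" unfolding I_def by blast+
  then have \<mu>M: "\<mu> \<in> M" and pM: "of_nat p \<in> M" using \<open>I \<subseteq> M\<close> by auto
  have dvdM: "f \<in> M" if "\<mu> dvd f" for f using that \<mu>M mult_mem' by (metis dvdE)
  have ord: "x ^ i - 1 \<notin> M" if "0 < i" "i < N" for i
  proof
    assume "x ^ i - 1 \<in> M"
    then have xi: "eqv (x ^ i) 1" by (simp add: eqv_def)
    have xN: "eqv (x ^ N) 1" using dvdM[OF dv] by (simp add: eqv_def)
    obtain e c where e: "0 < e" "e \<le> i" and c: "N = e * c"
      and "eqv (\<Sum>j<c. (x ^ e) ^ j) (of_nat c)"
      by (rule power_order_geometric[OF xi \<open>0 < i\<close> xN])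
    then have geo: "(\<Sum>j<c. (x ^ e) ^ j) - of_nat c \<in> M" by (simp add: eqv_def)
    define \<Psi> where "\<Psi> = (\<Sum>j<c. (x ^ e) ^ j)"
    have "x ^ N - 1 = (x ^ e - 1) * \<Psi>"
      unfolding c \<Psi>_def by (simp add: power_mult power_diff_1_eq)
    then have "\<mu> dvd x ^ e - 1 \<or> \<mu> dvd \<Psi>" using pr dv by (simp add: prime_elem_dvd_mult_iff)
    moreover have "\<not> \<mu> dvd x ^ e - 1"
    proof
      assume "\<mu> dvd x ^ e - 1"
      then have "ev (x ^ e - 1) = 0" using \<mu>(2) by (auto simp: ev_def poly_of_int_mult elim!: dvdE)
      then show False using cis_power_neq_1[of e N] e \<open>i < N\<close> by (simp add: ev \<zeta>_def)
    qed
    ultimately have "\<Psi> \<in> M" using dvdM by blast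
    then have cM: "of_nat c \<in> M" using diff_mem[OF _ geo, of \<Psi>] by (simp add: \<Psi>_def)
    have "coprime c (p ^ k)"
    proof (rule coprimeI)
      fix d assume "d dvd c" "d dvd p ^ k"
      moreover have "c dvd p ^ k - 1" using c N by simp
      ultimately have "d dvd p ^ k - (p ^ k - 1)" by (meson dvd_diff_nat dvd_trans)
      then show "is_unit d" using \<open>p ^ k > 1\<close> by simp
    qed
    then have "coprime (int c) (int p)" using N by (simp add: coprime_int_iff)
    then obtain u v where "u * int c + v * int p = 1" by (metis bezout_int coprime_imp_gcd_eq_1)
    then have "of_int u * of_nat c + of_int v * of_nat p = (1 :: int poly)"
      by (metis of_int_1 of_int_add of_int_mult of_int_of_nat_eq)
    then show False using one add_mem[OF mult_mem[OF cM] mult_mem[OF pM]] by metis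
  qed
  show thesis using that[OF M pM dvdM[OF dv] ord] .
qed

section \<open>The field with \<open>q\<close> elements as coordinates of an affine plane\<close>

context max_ideal
begin

text \<open>The roots of \<open>z ^ q - z\<close> in the quotient form a field and are numbered from
  \<open>0\<close> to \<open>q - 1\<close>. In terms of the numbered elements,
  \<open>L s a b\<close> is the number of \<open>b - s * a\<close>, so two points with different
  abscissae share a line exactly for the slope \<open>(b - b') / (a - a')\<close>.\<close>

lemma affine_coordinates:
  assumes p: "Factorial_Ring.prime (p :: nat)" "of_nat p \<in> M" and k: "k > 0" and N: "N = p ^ k - 1"
    and xN: "x ^ N - 1 \<in> M" and ord: "\<And>i. 0 < i \<Longrightarrow> i < N \<Longrightarrow> x ^ i - 1 \<notin> M"
  shows "\<exists>L :: nat \<Rightarrow> nat \<Rightarrow> nat \<Rightarrow> nat.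
    (\<forall>s a b. L s a b < p ^ k) \<and>
    (\<forall>s a b b'. b < p ^ k \<longrightarrow> b' < p ^ k \<longrightarrow> L s a b = L s a b' \<longrightarrow> b = b') \<and>
    (\<forall>a b a' b'. a < p ^ k \<longrightarrow> a' < p ^ k \<longrightarrow> a \<noteq> a' \<longrightarrow> (\<exists>!s. s < p ^ k \<and> L s a b = L s a' b'))"
proof -
  define q where q: "q = p ^ k"
  have "q > 1" using p k q by (metis one_less_power prime_gt_1_nat)
  then have qN: "q = Suc N" "N > 0" using N q by auto
  have one0: "\<not> 1 \<sim> 0" using one by (simp add: eqv_0_iff)
  have xN1: "x ^ N \<sim> 1" using xN by (simp add: eqv_def)
  have x0: "\<not> x ^ n \<sim> 0" for n
  proof
    assume "x ^ n \<sim> 0"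
    then have "x \<sim> 0" by (rule power_eqv_0)
    then have "x ^ N \<sim> 0" using eqv_power[of x 0 N] qN by (simp add: power_0_left)
    then show False using xN1 one0 eqv_sym eqv_trans by blast
  qed
  \<comment> \<open>Number \<open>0\<close> stands for zero and \<open>i > 0\<close> for
    \<open>x ^ (i - 1)\<close>, so that the numbers from \<open>1\<close> to \<open>q - 1\<close>
    run through the exponents below \<open>N\<close>.\<close>
  define el where "el = (\<lambda>i. if i = 0 then 0 else x ^ (i - 1))"
  have el_less: "i = j" if "i < q" "j < q" "el i \<sim> el j" "i \<le> j" for i j
  proof (rule ccontr)
    assume "i \<noteq> j"
    then have "i < j" using that by simp
    show False
    proof (cases "i = 0")
      case True
      then show ?thesis using that \<open>i < j\<close> x0 eqv_sym by (auto simp: el_def)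
    next
      case False
      then have "x ^ (i - 1) * 1 \<sim> x ^ (i - 1) * x ^ (j - i)"
        using that \<open>i < j\<close> by (simp add: el_def flip: power_add)
      then have "1 \<sim> x ^ (j - i)" using eqv_cancel x0 by blast
      then have "x ^ (j - i) - 1 \<in> M" using eqv_sym by (auto simp: eqv_def)
      moreover have "0 < j - i" "j - i < N" using False that \<open>i < j\<close> qN by linarith+
      ultimately show False using ord by blast
    qed
  qed
  then have el_inj: "i = j" if "i < q" "j < q" "el i \<sim> el j" for i j
    using that eqv_sym by (metis nat_le_linear)
  \<comment> \<open>Valid for every natural number \<open>i\<close>, also from \<open>q\<close> on;
    this is why \<open>L s a b < q\<close> holds for all arguments.\<close>
  have el_q: "el i ^ q \<sim> el i" for i
  proof (cases "i = 0")
    case False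
    have "el i ^ q = (x ^ N) ^ (i - 1) * x ^ (i - 1)"
      using False qN by (simp add: el_def mult.commute flip: power_mult power_add)
    also have "\<dots> \<sim> 1 ^ (i - 1) * x ^ (i - 1)" by (intro eqv_mult eqv_power xN1) simp
    finally show ?thesis using False by (simp add: el_def)
  qed (use \<open>q > 1\<close> in \<open>simp add: el_def power_0_left\<close>)
  \<comment> \<open>The numbered elements already provide \<open>q\<close> roots of
    \<open>z ^ q - z\<close>; one more would exceed its degree.\<close>
  have surj: "\<exists>i<q. el i \<sim> z" if z: "z ^ q \<sim> z" for z
  proof (rule ccontr)
    assume no: "\<not> ?thesis"
    let ?A = "insert z (el ` {..<q})" and ?f = "monom 1 q - monom 1 1  :: 'a poly"
    have inj: "inj_on el {..<q}" using el_inj by (intro inj_onI) auto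
    have "z \<notin> el ` {..<q}" using no by auto
    then have "card ?A = Suc q" using inj by (simp add: card_image)
    moreover have "card ?A \<le> q"
    proof (rule card_roots_le_degree[of ?f])
      show "coeff ?f q \<notin> M" using \<open>q > 1\<close> one by simp
      show "degree ?f \<le> q" using \<open>q > 1\<close> by (intro degree_diff_le) (auto simp: degree_monom_eq)
      show "poly ?f a \<in> M" if "a \<in> ?A" for a
        using that z el_q by (auto simp: poly_monom eqv_def)
      show "a = b" if ab: "a \<in> ?A" "b \<in> ?A" "a \<sim> b" for a b
      proof -
        consider "a = z" "b = z" | i where "i < q" "a = z" "b = el i" | i where "i < q" "a = el i" "b = z"
          | i j where "i < q" "j < q" "a = el i" "b = el j"
          using ab(1,2) by blast
        then show ?thesis
        proof cases
          case 2
          then show ?thesis using no ab(3) eqv_sym by blast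
        next
          case 3
          then show ?thesis using no ab(3) by blast
        next
          case 4
          then show ?thesis using el_inj[of i j] ab(3) by simp
        qed simp
      qed
    qed simp
    ultimately show False by simp
  qed
  define rep where "rep = (\<lambda>z. SOME i. i < q \<and> el i \<sim> z)"
  have rep: "rep z < q" "el (rep z) \<sim> z" if "z ^ q \<sim> z" for z
    using someI_ex[of "\<lambda>i. i < q \<and> el i \<sim> z"] surj[OF that] by (auto simp: rep_def)
  have rep_eq: "rep z = rep w \<longleftrightarrow> z \<sim> w" if "z ^ q \<sim> z" "w ^ q \<sim> w" for z w
  proof
    assume "rep z = rep w"
    then show "z \<sim> w" using eqv_trans[OF eqv_sym[OF rep(2)[OF that(1)]]] rep(2)[OF that(2)] by simp
  next
    assume "z \<sim> w"
    then have "el (rep z) \<sim> el (rep w)"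
      using eqv_trans[OF eqv_trans[OF rep(2)[OF that(1)]] eqv_sym[OF rep(2)[OF that(2)]]] by simp
    then show "rep z = rep w" using el_inj rep(1) that by blast
  qed
  \<comment> \<open>The roots of \<open>z ^ q - z\<close> are closed under products and differences,
    so the argument of \<open>rep\<close> in \<open>L\<close> is always a root.\<close>
  have mult_q: "(z * w) ^ q \<sim> z * w" if "z ^ q \<sim> z" "w ^ q \<sim> w" for z w
    using eqv_mult[OF that] by (simp add: power_mult_distrib)
  have diff_q: "(z - w) ^ q \<sim> z - w" if "z ^ q \<sim> z" "w ^ q \<sim> w" for z w
    using eqv_trans[OF eqv_freshmans_dream_diff[OF p, of z w k, folded q] eqv_diff[OF that]] .
  define L where "L = (\<lambda>s a b. rep (el b - el s * el a))"
  have L_q: "(el b - el s * el a) ^ q \<sim> el b - el s * el a" for s a b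
    by (intro diff_q mult_q el_q)
  have L_eq: "L s a b = L s a' b' \<longleftrightarrow> el s * (el a - el a') \<sim> el b - el b'" for s a b a' b'
  proof -
    have "L s a b = L s a' b' \<longleftrightarrow> el b - el s * el a \<sim> el b' - el s * el a'"
      unfolding L_def by (intro rep_eq L_q)
    also have "\<dots> \<longleftrightarrow> el b - el b' \<sim> el s * (el a - el a')"
      by (simp add: eqv_def algebra_simps)
    finally show ?thesis using eqv_sym[of "el b - el b'"] eqv_sym[of _ "el b - el b'"] by blast
  qed
  show ?thesis
    unfolding q[symmetric]
  proof (intro exI[of _ L] conjI allI impI)
    show "L s a b < q" for s a b unfolding L_def by (intro rep L_q)
  next
    fix s a b b' assume "b < q" "b' < q" "L s a b = L s a b'"
    then have "0 \<sim> el b - el b'" by (simp add: L_eq)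
    then have "el b \<sim> el b'" using eqv_sym[of 0] by (simp add: eqv_def)
    then show "b = b'" using el_inj \<open>b < q\<close> \<open>b' < q\<close> by blast
  next
    fix a b a' b' assume a: "a < q" "a' < q" "a \<noteq> a'"
    let ?d = "el a - el a'"
    have d0: "\<not> ?d \<sim> 0" using a el_inj[of a a'] by (auto simp: eqv_def)
    obtain c where c: "?d * c \<sim> 1" using inv[of ?d] d0 by (auto simp: eqv_def)
    \<comment> \<open>\<open>inv\<close> gives an inverse somewhere in the quotient; cancelling
      \<open>?d\<close> shows that it is a root of \<open>z ^ q - z\<close> as well, hence one of
      the numbered elements.\<close>
    have "?d * c ^ q \<sim> ?d * c"
    proof -
      have "?d ^ q \<sim> ?d" by (intro diff_q el_q)
      from eqv_mult[OF eqv_sym[OF this] eqv_refl[of "c ^ q"]]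
      have "?d * c ^ q \<sim> (?d * c) ^ q" by (simp add: power_mult_distrib)
      also have "(?d * c) ^ q \<sim> 1" using eqv_power[OF c, of q] by simp
      finally show ?thesis using eqv_trans[OF _ eqv_sym[OF c]] by simp
    qed
    then have cq: "c ^ q \<sim> c" using eqv_cancel d0 by blast
    let ?w = "(el b - el b') * c"
    have w: "?w ^ q \<sim> ?w" by (intro mult_q diff_q el_q cq)
    show "\<exists>!s. s < q \<and> L s a b = L s a' b'"
    proof (rule ex1I[of _ "rep ?w"])
      have "el (rep ?w) * ?d \<sim> ?w * ?d" by (intro eqv_mult rep w) simp
      also have "?w * ?d = (el b - el b') * (?d * c)" by (simp add: algebra_simps)
      also have "\<dots> \<sim> (el b - el b') * 1" by (intro eqv_mult c) simp
      finally show "rep ?w < q \<and> L (rep ?w) a b = L (rep ?w) a' b'"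
        using rep[OF w] by (simp add: L_eq)
    next
      fix s assume s: "s < q \<and> L s a b = L s a' b'"
      then have "?d * el s \<sim> el b - el b'" by (simp add: L_eq mult.commute)
      also have "el b - el b' \<sim> ?d * el (rep ?w)"
      proof -
        have "?d * el (rep ?w) \<sim> ?d * ?w" by (intro eqv_mult rep w) simp
        also have "?d * ?w = (el b - el b') * (?d * c)" by (simp add: algebra_simps)
        also have "\<dots> \<sim> (el b - el b') * 1" by (intro eqv_mult c) simp
        finally show ?thesis by (simp add: eqv_sym)
      qed
      finally have "el s \<sim> el (rep ?w)" using eqv_cancel d0 by blast
      then show "s = rep ?w" using s rep[OF w] el_inj by blast
    qed
  qed
qed

end

text \<open>\<open>L s a b\<close> is the intercept of the line of slope \<open>s\<close> through \<open>(a, b)\<close>.\<close>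

lemma exists_affine_coordinates:
  assumes "primepow q"
  shows "\<exists>L :: nat \<Rightarrow> nat \<Rightarrow> nat \<Rightarrow> nat.
    (\<forall>s a b. L s a b < q) \<and>
    (\<forall>s a b b'. b < q \<longrightarrow> b' < q \<longrightarrow> L s a b = L s a b' \<longrightarrow> b = b') \<and>
    (\<forall>a b a' b'. a < q \<longrightarrow> a' < q \<longrightarrow> a \<noteq> a' \<longrightarrow> (\<exists>!s. s < q \<and> L s a b = L s a' b'))"
proof -
  obtain p k where p: "prime p" and k: "k > 0" and q: "q = p ^ k"
    using assms unfolding primepow_def by blast
  obtain M :: "int poly set" and x where M: "max_ideal M" "of_nat p \<in> M" "x ^ (p ^ k - 1) - 1 \<in> M"
    "\<And>i. 0 < i \<Longrightarrow> i < p ^ k - 1 \<Longrightarrow> x ^ i - 1 \<notin> M"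
    using exists_primitive_root_ideal[OF p refl k] by blast
  show ?thesis
    unfolding q by (rule max_ideal.affine_coordinates[OF M(1) p M(2) k refl M(3,4)])
qed

subsection \<open>Colouring an affine plane\<close>

text \<open>Colours \<open>i < q\<close> are the slopes, \<open>q\<close> is the vertical class, and \<open>lin i x\<close> is the line of
  class \<open>i\<close> through \<open>x\<close>. The values \<open>\<chi> x x\<close> are chosen such that no line is constantly coloured by
  its own class; this makes the last inequality strict.\<close>

lemma exists_plane_colouring:
  assumes "primepow q"
  shows "\<exists>(\<chi> :: nat \<times> nat \<Rightarrow> nat \<times> nat \<Rightarrow> nat) (lin :: nat \<Rightarrow> nat \<times> nat \<Rightarrow> nat).
    (\<forall>x y. \<chi> x y = \<chi> y x) \<and>
    (\<forall>x\<in>{..<q} \<times> {..<q}. \<forall>y\<in>{..<q} \<times> {..<q}.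
      \<chi> x y \<le> q \<and> lin (\<chi> x y) x = lin (\<chi> x y) y) \<and>
    (\<forall>i. \<forall>x\<in>{..<q} \<times> {..<q}. lin i x < q) \<and>
    (\<forall>i t. card {(x, y). x \<in> {..<q} \<times> {..<q} \<and> y \<in> {..<q} \<times> {..<q} \<and> \<chi> x y = i \<and> lin i x = t} < q\<^sup>2)"
proof -
  obtain L :: "nat \<Rightarrow> nat \<Rightarrow> nat \<Rightarrow> nat" where L: "(\<forall>s a b. L s a b < q) \<and>
    (\<forall>s a b b'. b < q \<longrightarrow> b' < q \<longrightarrow> L s a b = L s a b' \<longrightarrow> b = b') \<and>
    (\<forall>a b a' b'. a < q \<longrightarrow> a' < q \<longrightarrow> a \<noteq> a' \<longrightarrow> (\<exists>!s. s < q \<and> L s a b = L s a' b'))"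
    using exists_affine_coordinates[OF assms] by (elim exE)
  then have L_less: "\<And>s a b. L s a b < q"
    and L_inj: "\<And>s a b b'. b < q \<Longrightarrow> b' < q \<Longrightarrow> L s a b = L s a b' \<Longrightarrow> b = b'"
    by simp_all
  have L_slope: "\<exists>!s. s < q \<and> L s a b = L s a' b'" if "a < q" "a' < q" "a \<noteq> a'" for a b a' b'
    using L that by simp
  have q: "q > 1" using primepow_gt_Suc_0[OF assms] by simp
  have L_surj: "\<exists>b<q. L s a b = t" if "t < q" for s a t
  proof -
    have "L s a ` {..<q} = {..<q}"
      using L_less L_inj by (intro endo_inj_surj) (auto intro!: inj_onI)
    then show ?thesis using that by (metis imageE lessThan_iff)
  qed
  define P where "P = {..<q} \<times> {..<q}"
  define lin where "lin = (\<lambda>i (a, b). if i < q then L i a b else a)"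
  \<comment> \<open>The diagonal colour of \<open>(a, b)\<close> is \<open>0\<close> if its line of
    class \<open>0\<close> has number \<open>a\<close>, and \<open>q\<close> otherwise. So each
    vertical line has a point coloured \<open>0\<close>, and line \<open>t\<close> of class
    \<open>0\<close> has points with \<open>a \<noteq> t\<close>, which are coloured
    \<open>q\<close>.\<close>
  define \<chi> where "\<chi> = (\<lambda>(a, b) (a', b').
    if a \<noteq> a' then THE s. s < q \<and> L s a b = L s a' b'
    else if b \<noteq> b' then q else if L 0 a b = a then 0 else q)"
  have slope: "\<chi> (a, b) (a', b') < q \<and> L (\<chi> (a, b) (a', b')) a b = L (\<chi> (a, b) (a', b')) a' b'"
    if "a < q" "a' < q" "a \<noteq> a'" for a b a' b'
    using theI'[OF L_slope[OF that, of b b']] that(3) by (simp add: \<chi>_def)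
  have sym: "\<chi> x y = \<chi> y x" for x y
    by (cases x; cases y) (auto simp: \<chi>_def intro: arg_cong[of _ _ The] simp: eq_commute)
  have le: "\<chi> x y \<le> q" if "x \<in> P" "y \<in> P" for x y
    using that slope[of "fst x" "fst y" "snd x" "snd y"]
    by (cases "fst x = fst y") (auto simp: P_def \<chi>_def split: prod.splits)
  have line: "lin (\<chi> x y) x = lin (\<chi> x y) y" if "x \<in> P" "y \<in> P" for x y
  proof (cases "fst x = fst y")
    case True
    then show ?thesis by (auto simp: \<chi>_def lin_def split: prod.splits)
  next
    case False
    then show ?thesis using that slope[of "fst x" "fst y" "snd x" "snd y"]
      by (auto simp: P_def lin_def)
  qed
  have l_less: "lin i x < q" if "x \<in> P" for i x
    using that L_less by (auto simp: P_def lin_def)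
  have card_lt: "card {(x, y). x \<in> P \<and> y \<in> P \<and> \<chi> x y = i \<and> lin i x = t} < q\<^sup>2" for i t
  \<comment> \<open>A member of the set supplies \<open>t < q\<close> and a point \<open>u\<close>
    on the line; without one the bound is immediate.\<close>
  proof (cases "{(x, y). x \<in> P \<and> y \<in> P \<and> \<chi> x y = i \<and> lin i x = t} = {}")
    case True
    then show ?thesis using q by (simp only: card.empty) simp
  next
    case False
    then obtain u v where uv: "u \<in> P" "v \<in> P" "\<chi> u v = i" "lin i u = t" by auto
    have "t < q" using l_less uv by blast
    have "i \<le> q" using le uv by blast
    have "\<exists>p\<in>P. lin i p = t \<and> \<chi> p p \<noteq> i"
    proof (cases "i = q")
      case True
      obtain b where "b < q" "L 0 t b = t" using L_surj \<open>t < q\<close> by blast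
      then show ?thesis using True \<open>t < q\<close> q
        by (intro bexI[of _ "(t, b)"]) (auto simp: lin_def \<chi>_def P_def)
    next
      case False
      show ?thesis
      proof (cases "i = 0")
        case True
        obtain a where "a < q" "a \<noteq> t" using q by (metis One_nat_def less_trans zero_less_one zero_neq_one)
        moreover obtain b where "b < q" "L 0 a b = t" using L_surj \<open>t < q\<close> by blast
        ultimately show ?thesis using True q
          by (intro bexI[of _ "(a, b)"]) (auto simp: lin_def \<chi>_def P_def)
      next
        case i: False
        then show ?thesis using uv False
          by (intro bexI[of _ u]) (auto simp: \<chi>_def split: prod.splits)
      qed
    qed
    then obtain p where p: "p \<in> P" "lin i p = t" "\<chi> p p \<noteq> i" by blast
    define A where "A = {x \<in> P. lin i x = t}"
    have finA: "finite A" by (simp add: A_def P_def)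
    have "card A \<le> card {..<q}"
    proof (cases "i < q")
      case True
      then have "inj_on fst A"
        using L_inj by (auto simp: A_def P_def lin_def inj_on_def)
      then show ?thesis by (rule card_inj_on_le) (auto simp: A_def P_def)
    next
      case False
      then have "inj_on snd A" by (auto simp: A_def lin_def inj_on_def)
      then show ?thesis by (rule card_inj_on_le) (auto simp: A_def P_def)
    qed
    then have cA: "card A \<le> q" by simp
    \<comment> \<open>\<open>A\<close> is the whole line, with at most \<open>q\<close> points, and
      contains both points of each counted pair. The missing pair \<open>(p, p)\<close> is the
      saving of one.\<close>
    have "{(x, y). x \<in> P \<and> y \<in> P \<and> \<chi> x y = i \<and> lin i x = t} \<subseteq> A \<times> A - {(p, p)}"
      using p by (auto simp: A_def; metis line)
    then have "card {(x, y). x \<in> P \<and> y \<in> P \<and> \<chi> x y = i \<and> lin i x = t} \<le> card (A \<times> A - {(p, p)})"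
      using finA by (intro card_mono) auto
    also have "\<dots> < card (A \<times> A)"
      using finA p by (intro psubset_card_mono) (auto simp: A_def)
    also have "\<dots> \<le> q\<^sup>2"
      using cA by (simp add: card_cartesian_product power2_eq_square mult_mono)
    finally show ?thesis .
  qed
  show ?thesis
    unfolding P_def[symmetric]
    by (intro exI[of _ \<chi>] exI[of _ lin] conjI allI ballI sym le line l_less card_lt)
qed

subsection \<open>Balanced distributions of the vertices\<close>

lemma card_PiE_fixed:
  assumes "finite W" "A \<subseteq> W" "h ` A \<subseteq> P" "finite P"
  shows "card {\<phi> \<in> W \<rightarrow>\<^sub>E P. \<forall>a\<in>A. \<phi> a = h a} = card P ^ card (W - A)"
proof -
  have "{\<phi> \<in> W \<rightarrow>\<^sub>E P. \<forall>a\<in>A. \<phi> a = h a} = (\<Pi>\<^sub>E w\<in>W. if w \<in> A then {h w} else P)"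
  proof (intro set_eqI iffI)
    fix \<phi> assume "\<phi> \<in> (\<Pi>\<^sub>E w\<in>W. if w \<in> A then {h w} else P)"
    then show "\<phi> \<in> {\<phi> \<in> W \<rightarrow>\<^sub>E P. \<forall>a\<in>A. \<phi> a = h a}"
      using assms by (fastforce simp: PiE_iff split: if_splits)
  qed (auto simp: PiE_iff)
  moreover have "card (\<Pi>\<^sub>E w\<in>W. if w \<in> A then {h w} else P) =
      (\<Prod>w\<in>W. if w \<in> A then 1 else card P)"
    using assms by (subst card_PiE) (auto intro!: prod.cong)
  moreover have "\<dots> = card P ^ card (W - A)"
    using assms by (simp add: prod.If_cases Diff_eq)
  ultimately show ?thesis by simp
qed

text \<open>Under a uniformly random \<open>\<phi>\<close> the images of two distinct vertices are
  independent and uniform, so they form a pair in \<open>S\<close> with probability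
  \<open>card S / card P ^ 2\<close>; denominators are cleared.\<close>

lemma card_PiE_pair:
  assumes "finite W" "u \<in> W" "v \<in> W" "u \<noteq> v" "S \<subseteq> P \<times> P" "finite P"
  shows "card {\<phi> \<in> W \<rightarrow>\<^sub>E P. (\<phi> u, \<phi> v) \<in> S} * card P ^ 2 = card S * card P ^ card W"
proof -
  let ?X = "\<lambda>(a, b). {\<phi> \<in> W \<rightarrow>\<^sub>E P. \<forall>w\<in>{u, v}. \<phi> w = (if w = u then a else b)}"
  have fin: "finite (W \<rightarrow>\<^sub>E P)" "finite S"
    using assms finite_PiE finite_subset[of S "P \<times> P"] by auto
  have "{\<phi> \<in> W \<rightarrow>\<^sub>E P. (\<phi> u, \<phi> v) \<in> S} = (\<Union>s\<in>S. ?X s)"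
    using \<open>u \<noteq> v\<close> by fastforce
  moreover have "card (\<Union>s\<in>S. ?X s) = (\<Sum>s\<in>S. card (?X s))"
    using fin \<open>u \<noteq> v\<close> by (intro card_UN_disjoint) auto
  moreover have "card (?X s) = card P ^ card (W - {u, v})" if "s \<in> S" for s
  proof -
    obtain a b where ab: "s = (a, b)" by (cases s)
    show ?thesis
      unfolding ab prod.case using assms that ab by (intro card_PiE_fixed) auto
  qed
  ultimately have "card {\<phi> \<in> W \<rightarrow>\<^sub>E P. (\<phi> u, \<phi> v) \<in> S} = card S * card P ^ card (W - {u, v})"
    by simp
  moreover have "card W = card (W - {u, v}) + 2"
    using card_Diff_subset[of "{u, v}" W] card_mono[of W "{u, v}"] assms by simp
  ultimately show ?thesis
    by (simp only: power_add)
qed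

text \<open>Disjoint pairs of vertices are mapped independently; this makes the covariances of
  disjoint edges vanish.\<close>

lemma card_PiE_two_pairs:
  assumes "finite W" "distinct [u, v, x, y]" "{u, v, x, y} \<subseteq> W" "S \<subseteq> P \<times> P" "finite P"
  shows "card {\<phi> \<in> W \<rightarrow>\<^sub>E P. (\<phi> u, \<phi> v) \<in> S \<and> (\<phi> x, \<phi> y) \<in> S} * card P ^ 4 =
    card S ^ 2 * card P ^ card W"
proof -
  let ?X = "\<lambda>(s, t). {\<phi> \<in> W \<rightarrow>\<^sub>E P. \<forall>w\<in>{u, v, x, y}. \<phi> w =
    (if w = u then fst s else if w = v then snd s else if w = x then fst t else snd t)}"
  have fin: "finite (W \<rightarrow>\<^sub>E P)" "finite S"
    using assms finite_PiE finite_subset[of S "P \<times> P"] by auto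
  have "{\<phi> \<in> W \<rightarrow>\<^sub>E P. (\<phi> u, \<phi> v) \<in> S \<and> (\<phi> x, \<phi> y) \<in> S} = (\<Union>z\<in>S \<times> S. ?X z)"
    using assms(2) by auto
  moreover have "card (\<Union>z\<in>S \<times> S. ?X z) = (\<Sum>z\<in>S \<times> S. card (?X z))"
    using fin assms(2) by (intro card_UN_disjoint) auto
  moreover have "card (?X z) = card P ^ card (W - {u, v, x, y})" if z: "z \<in> S \<times> S" for z
  proof -
    obtain s t where st: "z = (s, t)" by (cases z)
    show ?thesis
      unfolding st prod.case using assms z st by (intro card_PiE_fixed) auto
  qed
  ultimately have "card {\<phi> \<in> W \<rightarrow>\<^sub>E P. (\<phi> u, \<phi> v) \<in> S \<and> (\<phi> x, \<phi> y) \<in> S} =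
      card S ^ 2 * card P ^ card (W - {u, v, x, y})"
    by (simp add: card_cartesian_product power2_eq_square)
  moreover have "card W = card (W - {u, v, x, y}) + 4"
  proof -
    have "card {u, v, x, y} = 4"
      using distinct_card[OF assms(2)] by simp
    then show ?thesis
      using assms(1,3) by (metis card_Diff_subset card_mono finite_subset le_add_diff_inverse2)
  qed
  ultimately show ?thesis
    by (simp only: power_add)
qed

text \<open>Second moment method over a uniform \<open>\<phi>\<close>: only pairs of edges sharing a
  vertex contribute to the variance of the number of edges falling into \<open>S j\<close>, at most
  \<open>2 * D\<close> of them for each edge. Averaging the squared deviations summed over
  \<open>J\<close> yields one \<open>\<phi>\<close> that serves every \<open>j\<close>, at the price
  of the factor \<open>card J\<close>.\<close>

lemma exists_balanced_map:
  fixes W :: "'v set" and P :: "'p set" and S :: "'j \<Rightarrow> ('p \<times> 'p) set" and D :: nat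
  assumes WF: "fin_graph W F"
    and deg: "\<And>v. v \<in> W \<Longrightarrow> card {e \<in> F. v \<in> e} \<le> D"
    and P: "finite P" "P \<noteq> {}" and J: "finite J"
    and S: "\<And>j. j \<in> J \<Longrightarrow> S j \<subseteq> P \<times> P"
    and sym: "\<And>j. j \<in> J \<Longrightarrow> sym (S j)"
  shows "\<exists>\<phi> \<in> W \<rightarrow>\<^sub>E P. \<forall>j\<in>J.
    real (card {e \<in> F. \<exists>u v. e = {u, v} \<and> (\<phi> u, \<phi> v) \<in> S j}) \<le>
      real (card F) * real (card (S j)) / real (card P) ^ 2
        + sqrt (2 * real (card J) * real D * real (card F))"
proof -
  define \<Omega> where "\<Omega> = W \<rightarrow>\<^sub>E P"
  have finW: "finite W" and F: "F \<subseteq> [W]\<^bsup>2\<^esup>" using WF by (auto simp: fin_graph_def)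
  then have finF: "finite F" by (meson finite_subset finite_imp_finite_nsets)
  have fin\<Omega>: "finite \<Omega>" and ne\<Omega>: "\<Omega> \<noteq> {}" and card\<Omega>: "card \<Omega> = card P ^ card W"
    using P finW by (auto simp: \<Omega>_def finite_PiE PiE_eq_empty_iff card_PiE)
  have kpos: "card P > 0" using P by (simp add: card_gt_0_iff)
  have "\<exists>u v. e = {u, v} \<and> u \<noteq> v \<and> u \<in> W \<and> v \<in> W" if "e \<in> F" for e
    using that F by (fastforce simp: nsets_def card_2_iff)
  \<comment> \<open>An arbitrary orientation of each edge; by symmetry of \<open>S j\<close> the
    counts do not depend on it.\<close>
  then obtain s t where st: "\<And>e. e \<in> F \<Longrightarrow> e = {s e, t e} \<and> s e \<noteq> t e \<and> s e \<in> W \<and> t e \<in> W"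
    by metis
  define I where "I = (\<lambda>j e \<phi>. of_bool ((\<phi> (s e), \<phi> (t e)) \<in> S j) :: real)"
  define \<sigma> where "\<sigma> = (\<lambda>j. real (card (S j)) / real (card P) ^ 2)"
  define Z where "Z = (\<lambda>j \<phi>. (\<Sum>e\<in>F. I j e \<phi>))"
  have Z_eq: "Z j \<phi> = real (card {e \<in> F. \<exists>u v. e = {u, v} \<and> (\<phi> u, \<phi> v) \<in> S j})"
    if "j \<in> J" for j \<phi>
  proof -
    have "{e \<in> F. \<exists>u v. e = {u, v} \<and> (\<phi> u, \<phi> v) \<in> S j} = {e \<in> F. (\<phi> (s e), \<phi> (t e)) \<in> S j}"
      using st sym[OF that] by (auto simp: doubleton_eq_iff sym_def) (metis doubleton_eq_iff)+
    then show ?thesis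
      using finF by (simp add: Z_def I_def Int_def)
  qed
  have sumI: "(\<Sum>\<phi>\<in>\<Omega>. I j e \<phi>) = \<sigma> j * card \<Omega>" if "j \<in> J" "e \<in> F" for j e
  proof -
    have "real (card {\<phi> \<in> \<Omega>. (\<phi> (s e), \<phi> (t e)) \<in> S j}) * real (card P) ^ 2 = card (S j) * card \<Omega>"
      using arg_cong[OF card_PiE_pair[OF finW _ _ _ S[OF that(1)] P(1), of "s e" "t e"], of real]
        st[OF that(2)] card\<Omega> by (simp add: \<Omega>_def)
    then have "real (card {\<phi> \<in> \<Omega>. (\<phi> (s e), \<phi> (t e)) \<in> S j}) = \<sigma> j * card \<Omega>"
      using kpos by (simp add: \<sigma>_def field_simps)
    then show ?thesis
      using fin\<Omega> by (simp add: I_def Int_def)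
  qed
  have sumII: "(\<Sum>\<phi>\<in>\<Omega>. I j e \<phi> * I j f \<phi>) = \<sigma> j ^ 2 * card \<Omega>"
    if "j \<in> J" "e \<in> F" "f \<in> F" "e \<inter> f = {}" for j e f
  proof -
    have "distinct [s e, t e, s f, t f]" "{s e, t e, s f, t f} \<subseteq> W"
      using st[OF that(2)] st[OF that(3)] that(4) by (metis distinct_length_2_or_more distinct_singleton insert_iff disjoint_iff, blast)
    from arg_cong[OF card_PiE_two_pairs[OF finW this S[OF that(1)] P(1)], of real]
    have "real (card {\<phi> \<in> \<Omega>. (\<phi> (s e), \<phi> (t e)) \<in> S j \<and> (\<phi> (s f), \<phi> (t f)) \<in> S j}) * real (card P) ^ 4
        = real (card (S j)) ^ 2 * card \<Omega>"
      using card\<Omega> by (simp add: \<Omega>_def)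
    then have "real (card {\<phi> \<in> \<Omega>. (\<phi> (s e), \<phi> (t e)) \<in> S j \<and> (\<phi> (s f), \<phi> (t f)) \<in> S j})
        = \<sigma> j ^ 2 * card \<Omega>"
      using kpos by (simp add: \<sigma>_def field_simps power_divide flip: power_mult)
    then show ?thesis
      using fin\<Omega> by (simp add: I_def Int_def flip: of_bool_conj)
  qed
  have \<sigma>01: "0 \<le> \<sigma> j" "\<sigma> j \<le> 1" if "j \<in> J" for j
  proof -
    have "card (S j) \<le> card P ^ 2"
      using card_mono[OF _ S[OF that]] P by (simp add: card_cartesian_product power2_eq_square)
    then have "real (card (S j)) \<le> real (card P) ^ 2"
      by (metis of_nat_le_iff of_nat_power)
    then show "0 \<le> \<sigma> j" "\<sigma> j \<le> 1"
      using kpos by (auto simp: \<sigma>_def divide_simps)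
  qed
  have cov: "(\<Sum>\<phi>\<in>\<Omega>. (I j e \<phi> - \<sigma> j) * (I j f \<phi> - \<sigma> j)) \<le> of_bool (e \<inter> f \<noteq> {}) * real (card \<Omega>)"
    if "j \<in> J" "e \<in> F" "f \<in> F" for j e f
  proof (cases "e \<inter> f = {}")
    case True
    have "(\<Sum>\<phi>\<in>\<Omega>. (I j e \<phi> - \<sigma> j) * (I j f \<phi> - \<sigma> j)) =
      (\<Sum>\<phi>\<in>\<Omega>. I j e \<phi> * I j f \<phi>) - \<sigma> j * (\<Sum>\<phi>\<in>\<Omega>. I j e \<phi>) - \<sigma> j * (\<Sum>\<phi>\<in>\<Omega>. I j f \<phi>) + \<sigma> j ^ 2 * card \<Omega>"
      by (simp add: algebra_simps sum.distrib sum_subtractf sum_distrib_left power2_eq_square)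
    also have "\<dots> = 0"
      using sumI[OF that(1,2)] sumI[OF that(1,3)] sumII[OF that True]
      by (simp add: power2_eq_square)
    finally show ?thesis using True by simp
  next
    case False
    have "(I j e \<phi> - \<sigma> j) * (I j f \<phi> - \<sigma> j) \<le> 1" for \<phi>
    proof -
      have "\<bar>I j e \<phi> - \<sigma> j\<bar> \<le> 1" "\<bar>I j f \<phi> - \<sigma> j\<bar> \<le> 1"
        using \<sigma>01[OF that(1)] by (auto simp: I_def abs_le_iff)
      then have "\<bar>I j e \<phi> - \<sigma> j\<bar> * \<bar>I j f \<phi> - \<sigma> j\<bar> \<le> 1 * 1"
        by (intro mult_mono) auto
      then show ?thesis by (simp flip: abs_mult)
    qed
    then have "(\<Sum>\<phi>\<in>\<Omega>. (I j e \<phi> - \<sigma> j) * (I j f \<phi> - \<sigma> j)) \<le> (\<Sum>\<phi>\<in>\<Omega>. 1)"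
      by (intro sum_mono)
    then show ?thesis using False by simp
  qed
  have nb: "(\<Sum>f\<in>F. of_bool (e \<inter> f \<noteq> {}) :: real) \<le> 2 * D" if "e \<in> F" for e
  proof -
    have "{f \<in> F. e \<inter> f \<noteq> {}} \<subseteq> {f \<in> F. s e \<in> f} \<union> {f \<in> F. t e \<in> f}"
      using st[OF that] by (auto; metis insertE singletonD)
    then have "card {f \<in> F. e \<inter> f \<noteq> {}} \<le> card ({f \<in> F. s e \<in> f} \<union> {f \<in> F. t e \<in> f})"
      using finF by (intro card_mono) auto
    also have "\<dots> \<le> card {f \<in> F. s e \<in> f} + card {f \<in> F. t e \<in> f}"
      by (rule card_Un_le)
    also have "\<dots> \<le> D + D"
      using st[OF that] by (intro add_mono deg) auto
    finally show ?thesis using finF by (simp add: Int_def)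
  qed
  define V where "V = (\<lambda>j \<phi>. (Z j \<phi> - card F * \<sigma> j)\<^sup>2)"
  have var: "(\<Sum>\<phi>\<in>\<Omega>. V j \<phi>) \<le> card \<Omega> * (2 * D * card F)" if "j \<in> J" for j
  proof -
    have "V j \<phi> = (\<Sum>e\<in>F. \<Sum>f\<in>F. (I j e \<phi> - \<sigma> j) * (I j f \<phi> - \<sigma> j))" for \<phi>
    proof -
      have "Z j \<phi> - card F * \<sigma> j = (\<Sum>e\<in>F. I j e \<phi> - \<sigma> j)"
        by (simp add: Z_def sum_subtractf)
      then show ?thesis by (simp add: V_def power2_eq_square sum_product)
    qed
    then have "(\<Sum>\<phi>\<in>\<Omega>. V j \<phi>) = (\<Sum>e\<in>F. \<Sum>f\<in>F. \<Sum>\<phi>\<in>\<Omega>. (I j e \<phi> - \<sigma> j) * (I j f \<phi> - \<sigma> j))"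
      by (simp add: sum.swap[of _ F \<Omega>])
    also have "\<dots> \<le> (\<Sum>e\<in>F. \<Sum>f\<in>F. of_bool (e \<inter> f \<noteq> {}) * real (card \<Omega>))"
      by (intro sum_mono cov that)
    also have "\<dots> = (\<Sum>e\<in>F. (\<Sum>f\<in>F. of_bool (e \<inter> f \<noteq> {})) * real (card \<Omega>))"
      by (simp only: sum_distrib_right)
    also have "\<dots> \<le> (\<Sum>e\<in>F. 2 * real D * real (card \<Omega>))"
      by (intro sum_mono mult_right_mono) (use nb in auto)
    finally show ?thesis by (simp add: algebra_simps)
  qed
  have "\<exists>\<phi>\<in>\<Omega>. (\<Sum>j\<in>J. V j \<phi>) \<le> card J * (2 * D * card F)"
  proof (rule ccontr)
    assume "\<not> ?thesis"
    then have "(\<Sum>\<phi>\<in>\<Omega>. real (card J * (2 * D * card F))) < (\<Sum>\<phi>\<in>\<Omega>. \<Sum>j\<in>J. V j \<phi>)"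
      using fin\<Omega> ne\<Omega> by (intro sum_strict_mono) auto
    also have "\<dots> = (\<Sum>j\<in>J. \<Sum>\<phi>\<in>\<Omega>. V j \<phi>)" by (rule sum.swap)
    also have "\<dots> \<le> (\<Sum>j\<in>J. real (card \<Omega> * (2 * D * card F)))"
      by (intro sum_mono) (use var in simp)
    finally show False by (simp add: algebra_simps)
  qed
  then obtain \<phi> where \<phi>: "\<phi> \<in> \<Omega>" and le: "(\<Sum>j\<in>J. V j \<phi>) \<le> card J * (2 * D * card F)" by blast
  have "Z j \<phi> \<le> card F * \<sigma> j + sqrt (2 * card J * D * card F)" if "j \<in> J" for j
  proof -
    have "V j \<phi> \<le> (\<Sum>j\<in>J. V j \<phi>)"
      using J that by (intro member_le_sum) (auto simp: V_def)
    with le have "(Z j \<phi> - card F * \<sigma> j)\<^sup>2 \<le> 2 * card J * D * card F"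
      by (simp add: V_def algebra_simps)
    then have "Z j \<phi> - card F * \<sigma> j \<le> sqrt (2 * card J * D * card F)"
      by (rule real_le_rsqrt)
    then show ?thesis by simp
  qed
  with \<phi> Z_eq show ?thesis
    unfolding \<Omega>_def by (intro bexI[of _ \<phi>]) (auto simp: \<sigma>_def)
qed

subsection \<open>Size Ramsey numbers\<close>

lemma sum_degrees:
  assumes "fin_graph W F"
  shows "(\<Sum>v\<in>W. card {e \<in> F. v \<in> e}) = 2 * card F"
proof -
  have finW: "finite W" and F: "F \<subseteq> [W]\<^bsup>2\<^esup>" using assms by (auto simp: fin_graph_def)
  then have finF: "finite F" by (meson finite_subset finite_imp_finite_nsets)
  have "(\<Sum>v\<in>W. card {e \<in> F. v \<in> e}) = (\<Sum>v\<in>W. \<Sum>e\<in>F. of_bool (v \<in> e))"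
    using finF by (simp add: Int_def)
  also have "\<dots> = (\<Sum>e\<in>F. \<Sum>v\<in>W. of_bool (v \<in> e))" by (rule sum.swap)
  also have "\<dots> = (\<Sum>e\<in>F. 2)"
  proof (rule sum.cong)
    fix e assume "e \<in> F"
    then have "e \<subseteq> W" "card e = 2" using F by (auto simp: nsets_def)
    then have "{v \<in> W. v \<in> e} = e" by auto
    then show "(\<Sum>v\<in>W. of_bool (v \<in> e)) = (2 :: nat)"
      using finW \<open>card e = 2\<close> by (simp add: Int_def)
  qed simp
  finally show ?thesis by simp
qed

lemma card_high_degree:
  assumes "fin_graph W F"
  shows "D * card {v \<in> W. card {e \<in> F. v \<in> e} > D} \<le> 2 * card F"
proof -
  let ?B = "{v \<in> W. card {e \<in> F. v \<in> e} > D}"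
  have finW: "finite W" using assms by (auto simp: fin_graph_def)
  have "D * card ?B = (\<Sum>v\<in>?B. D)" by simp
  also have "\<dots> \<le> (\<Sum>v\<in>?B. card {e \<in> F. v \<in> e})" by (intro sum_mono) auto
  also have "\<dots> \<le> (\<Sum>v\<in>W. card {e \<in> F. v \<in> e})"
    using finW by (intro sum_mono2) auto
  finally show ?thesis using sum_degrees[OF assms] by simp
qed

lemma card_le_independence_number:
  assumes "finite V" "S \<subseteq> V" "indep S E"
  shows "card S \<le> independence_number V E"
proof -
  have "{card S |S. S \<subseteq> V \<and> indep S E} \<subseteq> card ` Pow V" by auto
  then have "finite {card S |S. S \<subseteq> V \<and> indep S E}"
    using assms(1) finite_subset by blast
  then show ?thesis
    unfolding independence_number_def using assms by (intro Max_ge) auto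
qed

lemma connected_graph_constant:
  assumes "connected_graph V E" "u \<in> V" "v \<in> V" "\<And>x y. {x, y} \<in> E \<Longrightarrow> h x = h y"
  shows "h u = h v"
proof -
  have "(u, v) \<in> {(x, y). {x, y} \<in> E}\<^sup>*"
    using assms(1-3) by (simp add: connected_graph_def)
  then show ?thesis by induction (use assms(4) in auto)
qed

text \<open>A copy in colour \<open>q + 1\<close> is independent outside the set \<open>B\<close> of
  high-degree vertices, and \<open>D * card B \<le> 2 * card F\<close> then contradicts
  \<open>alpha\<close>. A copy in a colour \<open>i \<le> q\<close> lies over one line by
  connectedness, where the balanced map leaves too few edges by \<open>edges\<close>. The factor
  \<open>Suc q * q\<close> counts the lines: \<open>q + 1\<close> classes of \<open>q\<close>
  lines.\<close>

lemma not_arrows: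
  fixes V :: "'a set" and W :: "'b set"
  assumes q: "primepow q" and H: "fin_graph V E" "connected_graph V E" and G: "fin_graph W F"
    and alpha: "real D * real (independence_number V E) + 2 * real (card F) < real D * real (card V)"
    and edges: "real (card F) * real (q\<^sup>2 - 1) / real q ^ 4
      + sqrt (2 * real (Suc q * q) * real D * real (card F)) < real (card E)"
  shows "\<not> arrows W F (q + 2) V E"
proof
  assume arr: "arrows W F (q + 2) V E"
  obtain \<chi> :: "nat \<times> nat \<Rightarrow> nat \<times> nat \<Rightarrow> nat" and lin :: "nat \<Rightarrow> nat \<times> nat \<Rightarrow> nat"
    where \<chi>: "(\<forall>x y. \<chi> x y = \<chi> y x) \<and>
    (\<forall>x\<in>{..<q} \<times> {..<q}. \<forall>y\<in>{..<q} \<times> {..<q}.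
      \<chi> x y \<le> q \<and> lin (\<chi> x y) x = lin (\<chi> x y) y) \<and>
    (\<forall>i. \<forall>x\<in>{..<q} \<times> {..<q}. lin i x < q) \<and>
    (\<forall>i t. card {(x, y). x \<in> {..<q} \<times> {..<q} \<and> y \<in> {..<q} \<times> {..<q} \<and> \<chi> x y = i \<and> lin i x = t} < q\<^sup>2)"
    using exists_plane_colouring[OF q] by (elim exE)
  define P where "P = {..<q} \<times> {..<q}"
  have sym: "\<chi> x y = \<chi> y x" for x y using \<chi> by blast
  have \<chi>_le: "\<chi> x y \<le> q" and line: "lin (\<chi> x y) x = lin (\<chi> x y) y" if "x \<in> P" "y \<in> P" for x y
    using \<chi> that unfolding P_def by blast+
  have lin_less: "lin i x < q" if "x \<in> P" for i x
    using \<chi> that unfolding P_def by blast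
  have few: "card {(x, y). x \<in> P \<and> y \<in> P \<and> \<chi> x y = i \<and> lin i x = t} < q\<^sup>2" for i t
    using \<chi> unfolding P_def by blast
  have q1: "q > 1" using primepow_gt_Suc_0[OF q] by simp
  have cardP: "card P = q\<^sup>2" by (simp add: P_def card_cartesian_product power2_eq_square)
  define S where "S = (\<lambda>(i, t). {(a, b). a \<in> P \<and> b \<in> P \<and> \<chi> a b = i \<and> lin i a = t})"
  define B where "B = {v \<in> W. card {e \<in> F. v \<in> e} > D}"
  define F' where "F' = {e \<in> F. e \<inter> B = {}}"
  have finV: "finite V" and finW: "finite W" and E2: "E \<subseteq> [V]\<^bsup>2\<^esup>" and F2: "F \<subseteq> [W]\<^bsup>2\<^esup>"
    using H G by (auto simp: fin_graph_def)
  have finF: "finite F" using finW F2 by (meson finite_subset finite_imp_finite_nsets)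
  have G': "fin_graph W F'" using G by (auto simp: fin_graph_def F'_def)
  have F'_le: "card F' \<le> card F" using finF by (intro card_mono) (auto simp: F'_def)
  have deg: "card {e \<in> F'. v \<in> e} \<le> D" if "v \<in> W" for v
  proof (cases "v \<in> B")
    case True
    then have "{e \<in> F'. v \<in> e} = {}" by (auto simp: F'_def)
    then show ?thesis by (simp only: card.empty)
  next
    case False
    have "card {e \<in> F'. v \<in> e} \<le> card {e \<in> F. v \<in> e}"
      using finF by (intro card_mono) (auto simp: F'_def)
    then show ?thesis using False that by (simp add: B_def)
  qed
  have "\<exists>\<phi> \<in> W \<rightarrow>\<^sub>E P. \<forall>j\<in>{..q} \<times> {..<q}.
    real (card {e \<in> F'. \<exists>u v. e = {u, v} \<and> (\<phi> u, \<phi> v) \<in> S j}) \<le>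
      real (card F') * real (card (S j)) / real (card P) ^ 2
        + sqrt (2 * real (card ({..q} \<times> {..<q})) * real D * real (card F'))"
  proof (rule exists_balanced_map[OF G' deg])
    show "finite P" "P \<noteq> {}" using q1 by (auto simp: P_def intro!: exI[of _ 0])
    show "S j \<subseteq> P \<times> P" for j by (auto simp: S_def split: prod.splits)
    show "Relation.sym (S j)" for j
    proof (rule symI)
      fix x y assume "(x, y) \<in> S j"
      then have "x \<in> P" "y \<in> P" "j = (\<chi> x y, lin (\<chi> x y) x)"
        by (auto simp: S_def split: prod.splits)
      then show "(y, x) \<in> S j"
        using sym[of x y] line[of x y] by (simp add: S_def)
    qed
  qed auto
  then obtain \<phi> where \<phi>: "\<phi> \<in> W \<rightarrow>\<^sub>E P"
    and bal: "\<And>j. j \<in> {..q} \<times> {..<q} \<Longrightarrow>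
      real (card {e \<in> F'. \<exists>u v. e = {u, v} \<and> (\<phi> u, \<phi> v) \<in> S j}) \<le>
      real (card F') * real (card (S j)) / real (card P) ^ 2
        + sqrt (2 * real (card ({..q} \<times> {..<q})) * real D * real (card F'))" by blast
  \<comment> \<open>The definite description does not depend on the order of the ends because
    \<open>\<chi>\<close> is symmetric. Ends with the same image get the diagonal colour of that
    point.\<close>
  define c where "c = (\<lambda>e. if e \<inter> B \<noteq> {} then q + 1
    else THE k. \<exists>u v. e = {u, v} \<and> k = \<chi> (\<phi> u) (\<phi> v))"
  have c_eq: "c {u, v} = (if {u, v} \<inter> B \<noteq> {} then q + 1 else \<chi> (\<phi> u) (\<phi> v))" for u v
  proof -
    have "(THE k. \<exists>x y. {u, v} = {x, y} \<and> k = \<chi> (\<phi> x) (\<phi> y)) = \<chi> (\<phi> u) (\<phi> v)"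
      by (rule the_equality) (auto simp: doubleton_eq_iff sym[of "\<phi> v" "\<phi> u"])
    then show ?thesis by (simp add: c_def)
  qed
  have ends: "\<exists>u v. e = {u, v} \<and> u \<in> W \<and> v \<in> W" if "e \<in> F" for e
    using that F2 by (fastforce simp: nsets_def card_2_iff)
  have "c e < q + 2" if "e \<in> F" for e
  proof -
    from ends[OF that] obtain u v where "e = {u, v}" "u \<in> W" "v \<in> W" by blast
    then show ?thesis using \<chi>_le[of "\<phi> u" "\<phi> v"] \<phi> by (auto simp: c_eq PiE_iff)
  qed
  then have "c \<in> F \<rightarrow> {..<q + 2}" by auto
  then have "mono_copy V E W F c" using arr by (simp add: arrows_def)
  then obtain f i where f: "inj_on f V" "f ` V \<subseteq> W"
    and mono: "\<And>e. e \<in> E \<Longrightarrow> f ` e \<in> F \<and> c (f ` e) = i"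
    unfolding mono_copy_def by blast
  show False
  proof (cases "i = q + 1")
    case True
    \<comment> \<open>An edge of the copy that avoids \<open>B\<close> would have a colour at most
      \<open>q\<close>, so this part of the copy spans no edge.\<close>
    define T where "T = {v \<in> V. f v \<notin> B}"
    have "{u, v} \<notin> E" if "u \<in> T" "v \<in> T" for u v
    proof
      assume "{u, v} \<in> E"
      then have e: "{f u, f v} \<in> F" "c {f u, f v} = q + 1" using mono True by fastforce+
      moreover have "f u \<in> W" "f v \<in> W" using f that by (auto simp: T_def)
      moreover have "{f u, f v} \<inter> B = {}" using that by (auto simp: T_def)
      ultimately show False
        using \<chi>_le[of "\<phi> (f u)" "\<phi> (f v)"] \<phi> by (auto simp: c_eq PiE_iff)
    qed
    then have "indep T E" by (auto simp: indep_def)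
    then have "card T \<le> independence_number V E"
      using finV by (intro card_le_independence_number) (auto simp: T_def)
    moreover have "card (V - T) \<le> card B"
      using f finW by (intro card_inj_on_le[of f]) (auto simp: T_def B_def intro: inj_on_subset)
    moreover have "card V = card T + card (V - T)"
      using finV card_Diff_subset[of T V] card_mono[of V T] finite_subset[of T V] by (auto simp: T_def)
    ultimately have "card V \<le> independence_number V E + card B" by linarith
    then have "D * card V \<le> D * (independence_number V E + card B)" by (rule mult_le_mono2)
    also have "\<dots> \<le> D * independence_number V E + 2 * card F"
      using card_high_degree[OF G, of D] by (simp add: B_def algebra_simps)
    finally have "real (D * card V) \<le> real (D * independence_number V E + 2 * card F)"
      by (simp only: of_nat_le_iff)
    then show False using alpha by simp
  next
    case False
    have col: "{f u, f v} \<in> F' \<and> \<chi> (\<phi> (f u)) (\<phi> (f v)) = i \<and> u \<in> V \<and> v \<in> V \<and> \<phi> (f u) \<in> P \<and> \<phi> (f v) \<in> P"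
      if "{u, v} \<in> E" for u v
    proof -
      have "{f u, f v} \<in> F" "c {f u, f v} = i" using mono[OF that] by auto
      then have "{f u, f v} \<in> F'" "\<chi> (\<phi> (f u)) (\<phi> (f v)) = i"
        using False by (auto simp: c_eq F'_def split: if_splits)
      moreover have "u \<in> V" "v \<in> V" using that E2 by (auto simp: nsets_def)
      ultimately show ?thesis using f \<phi> by (auto simp: PiE_iff)
    qed
    \<comment> \<open>\<open>mono_copy\<close> restricts \<open>i\<close> only through edges. The
      strict bound \<open>edges\<close> forces \<open>E\<close> to be nonempty, and a single edge
      then gives \<open>i \<le> q\<close> and \<open>t < q\<close>.\<close>
    have "0 \<le> real (card F) * real (q\<^sup>2 - 1) / real q ^ 4
      + sqrt (2 * real (Suc q * q) * real D * real (card F))"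
      by (intro add_nonneg_nonneg divide_nonneg_nonneg mult_nonneg_nonneg real_sqrt_ge_zero) simp_all
    then have "real (card E) > 0" using edges by linarith
    then have "E \<noteq> {}" by auto
    then obtain e where "e \<in> E" by blast
    then obtain u v where uv: "{u, v} \<in> E" using E2 by (fastforce simp: nsets_def card_2_iff)
    define t where "t = lin i (\<phi> (f u))"
    have "i \<le> q" "t < q" using col[OF uv] \<chi>_le[of "\<phi> (f u)" "\<phi> (f v)"] lin_less[of "\<phi> (f u)"]
      by (auto simp: t_def)
    \<comment> \<open>Both ends of an edge of colour \<open>i\<close> lie on the same line of class
      \<open>i\<close>, and connectedness spreads this to the whole copy.\<close>
    have t: "lin i (\<phi> (f w)) = t" if "w \<in> V" for w
      unfolding t_def
    proof (rule connected_graph_constant[OF H(2) that])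
      show "u \<in> V" using col[OF uv] by simp
      show "lin i (\<phi> (f x)) = lin i (\<phi> (f y))" if "{x, y} \<in> E" for x y
        using col[OF that] line[of "\<phi> (f x)" "\<phi> (f y)"] by simp
    qed
    have sub: "(\<lambda>e. f ` e) ` E \<subseteq> {e \<in> F'. \<exists>u v. e = {u, v} \<and> (\<phi> u, \<phi> v) \<in> S (i, t)}"
    proof (rule image_subsetI)
      fix e assume e: "e \<in> E"
      then obtain x y where xy: "e = {x, y}" using E2 by (fastforce simp: nsets_def card_2_iff)
      then have "(\<phi> (f x), \<phi> (f y)) \<in> S (i, t)" "f ` e = {f x, f y}" "{f x, f y} \<in> F'"
        using col[of x y] t[of x] e by (auto simp: S_def)
      then show "f ` e \<in> {e \<in> F'. \<exists>u v. e = {u, v} \<and> (\<phi> u, \<phi> v) \<in> S (i, t)}"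
        by auto
    qed
    have card_im: "card ((\<lambda>e. f ` e) ` E) = card E"
    proof (rule card_image, rule inj_on_image)
      show "inj_on f (\<Union> E)" using E2 by (intro inj_on_subset[OF f(1)]) (auto simp: nsets_def)
    qed
    have "finite F'" using finF by (simp add: F'_def)
    then have "card E \<le> card {e \<in> F'. \<exists>u v. e = {u, v} \<and> (\<phi> u, \<phi> v) \<in> S (i, t)}"
      unfolding card_im[symmetric] by (intro card_mono sub) simp
    then have "real (card E) \<le> real (card F') * real (card (S (i, t))) / real q ^ 4
        + sqrt (2 * real (Suc q * q) * real D * real (card F'))"
      using bal[of "(i, t)"] \<open>i \<le> q\<close> \<open>t < q\<close> by (simp add: cardP card_cartesian_product flip: power_mult)
    also have "\<dots> \<le> real (card F) * real (q\<^sup>2 - 1) / real q ^ 4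
        + sqrt (2 * real (Suc q * q) * real D * real (card F))"
    proof -
      have "card (S (i, t)) \<le> q\<^sup>2 - 1" using few[of i t] by (simp add: S_def)
      then show ?thesis
        using F'_le by (intro add_mono divide_right_mono mult_mono real_sqrt_le_mono) auto
    qed
    finally show False using edges by simp
  qed
qed

section \<open>From host graphs to the bound for large \<open>n\<close>\<close>

lemma size_ramsey_attained:
  assumes "fin_graph V E"
  obtains W :: "nat set" and F where "fin_graph W F" "card F = size_ramsey V E r" "arrows W F r V E"
proof -
  have "\<exists>m. \<exists>(W :: nat set) F. fin_graph W F \<and> card F = m \<and> arrows W F r V E"
    using arrows_exists[OF assms] by blast
  then have "\<exists>(W :: nat set) F. fin_graph W F \<and> card F = size_ramsey V E r \<and> arrows W F r V E"
    unfolding size_ramsey_def by (rule LeastI_ex)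
  then show thesis using that by blast
qed

text \<open>Under a constant colouring the copy embeds \<open>E\<close> into \<open>F\<close>. This
  settles \<open>r = 3\<close>, where \<open>r - 2 = 1\<close> is not covered by
  \<open>primepow\<close>.\<close>

lemma card_edges_le_size_ramsey:
  assumes "fin_graph V E" "r > 0"
  shows "card E \<le> size_ramsey V E r"
proof -
  obtain W :: "nat set" and F where G: "fin_graph W F" "card F = size_ramsey V E r" "arrows W F r V E"
    using size_ramsey_attained[OF assms(1)] .
  have "(\<lambda>_. 0) \<in> F \<rightarrow> {..<r}" using assms(2) by auto
  then have "mono_copy V E W F (\<lambda>_. 0)" using G(3) by (simp add: arrows_def)
  then obtain f where f: "inj_on f V" "\<And>e. e \<in> E \<Longrightarrow> f ` e \<in> F"
    unfolding mono_copy_def by blast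
  have "finite F"
    using G(1) unfolding fin_graph_def by (meson finite_subset finite_imp_finite_nsets)
  moreover have "inj_on ((`) f) E"
  proof (rule inj_on_image)
    show "inj_on f (\<Union> E)"
      using assms(1) by (intro inj_on_subset[OF f(1)]) (auto simp: fin_graph_def nsets_def)
  qed
  ultimately show ?thesis
    unfolding G(2)[symmetric] using f(2) by (intro card_inj_on_le[of "(`) f"]) auto
qed

text \<open>Squaring gives an explicit threshold beyond which the second moment deviation stays
  below the linear gain.\<close>

lemma sqrt_linear_less:
  fixes K c x :: real
  assumes "c > 0" "x > K / c\<^sup>2" "x > 0"
  shows "sqrt (K * x) < c * x"
proof (rule real_less_lsqrt)
  show "0 \<le> c * x" using assms by simp
  have "K * x < (x * c\<^sup>2) * x" using assms by (intro mult_strict_right_mono) (auto simp: field_simps)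
  then show "K * x < (c * x)\<^sup>2" by (simp add: power2_eq_square algebra_simps)
qed

text \<open>In a host with at most \<open>n * d / 2 * q ^ 2\<close> edges, the density
  \<open>(q ^ 2 - 1) / q ^ 4\<close> of a line accounts for at most \<open>n * d / 2 - c * n\<close>
  edges, short of \<open>card E\<close> by a linear amount, while the deviation is at most
  \<open>sqrt (K * n)\<close>.\<close>

lemma size_ramsey_gt:
  fixes q :: nat and d \<beta> :: real
  assumes q: "primepow q" and d: "d > 0" and \<beta>: "\<beta> < 1"
  shows "\<exists>n\<^sub>0. \<forall>n\<ge>n\<^sub>0. \<forall>(V :: nat set) E.
      fin_graph V E \<and> card V = n \<and> connected_graph V E \<and>
      average_degree V E \<ge> d \<and> real (independence_number V E) \<le> \<beta> * real n \<longrightarrow>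
      real (size_ramsey V E (q + 2)) > real n * d / 2 * (real q)\<^sup>2"
proof -
  have q0: "q > 0" using primepow_gt_Suc_0[OF q] by simp
  \<comment> \<open>This choice gives
    \<open>2 * card F \<le> n * d * q ^ 2 < D * (1 - \<beta>) * n\<close>, hence the condition
    \<open>alpha\<close> of \<open>not_arrows\<close>.\<close>
  obtain D :: nat where D: "real D > d * (real q)\<^sup>2 / (1 - \<beta>)" using reals_Archimedean2 by blast
  \<comment> \<open>\<open>K * n\<close> bounds the radicand in the condition
    \<open>edges\<close>.\<close>
  define K where "K = real (Suc q * q) * real D * (d * (real q)\<^sup>2)"
  define c where "c = d / (2 * (real q)\<^sup>2)"
  have c: "c > 0" using d q0 by (simp add: c_def)
  \<comment> \<open>The threshold of \<open>sqrt_linear_less\<close>; starting from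
    \<open>Suc n0\<close> also ensures that \<open>n\<close> is positive.\<close>
  obtain n0 :: nat where n0: "real n0 > K / c\<^sup>2" using reals_Archimedean2 by blast
  have "real (size_ramsey V E (q + 2)) > real n * d / 2 * (real q)\<^sup>2"
    if n: "n \<ge> Suc n0" and H: "fin_graph V E" "card V = n" "connected_graph V E"
      "average_degree V E \<ge> d" "real (independence_number V E) \<le> \<beta> * real n"
    for n and V :: "nat set" and E
  proof (rule ccontr)
    assume "\<not> ?thesis"
    then have small: "real (size_ramsey V E (q + 2)) \<le> real n * d / 2 * (real q)\<^sup>2" by simp
    obtain W :: "nat set" and F where G: "fin_graph W F" "card F = size_ramsey V E (q + 2)"
      "arrows W F (q + 2) V E"
      using size_ramsey_attained[OF H(1)] .
    have npos: "real n > 0" using n by simp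
    have F: "real (card F) \<le> real n * d / 2 * (real q)\<^sup>2" using small G(2) by simp
    have E: "real (card E) \<ge> real n * d / 2"
      using H(2,4) npos by (simp add: average_degree_def field_simps)
    have "\<not> arrows W F (q + 2) V E"
    proof (rule not_arrows[OF q H(1,3) G(1)])
      have "d * (real q)\<^sup>2 < real D * (1 - \<beta>)" using D \<beta> by (simp add: field_simps)
      then have "real n * (d * (real q)\<^sup>2) < real n * (real D * (1 - \<beta>))"
        using npos by (rule mult_strict_left_mono)
      moreover have "real D * real (independence_number V E) \<le> real D * (\<beta> * real n)"
        using H(5) by (intro mult_left_mono) auto
      ultimately show "real D * real (independence_number V E) + 2 * real (card F) < real D * real (card V)"
        using F H(2) by (simp add: algebra_simps)
    next
      have "real (card F) * real (q\<^sup>2 - 1) / real q ^ 4 \<le>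
          (real n * d / 2 * (real q)\<^sup>2) * real (q\<^sup>2 - 1) / real q ^ 4"
        using F by (intro divide_right_mono mult_right_mono) auto
      also have "\<dots> = real n * d / 2 - c * real n"
      proof -
        have "real (q\<^sup>2 - 1) = (real q)\<^sup>2 - 1" using q0 by (simp add: of_nat_diff)
        moreover have "real q ^ 4 = (real q)\<^sup>2 * (real q)\<^sup>2" by (simp flip: power_add)
        ultimately show ?thesis using q0 by (simp add: c_def field_simps)
      qed
      finally have 1: "real (card F) * real (q\<^sup>2 - 1) / real q ^ 4 \<le> real n * d / 2 - c * real n" .
      have "2 * real (Suc q * q) * real D * real (card F) \<le>
          2 * real (Suc q * q) * real D * (real n * d / 2 * (real q)\<^sup>2)"
        using F by (intro mult_left_mono) auto
      also have "\<dots> = K * real n" by (simp add: K_def)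
      finally have "sqrt (2 * real (Suc q * q) * real D * real (card F)) \<le> sqrt (K * real n)"
        by (rule real_sqrt_le_mono)
      also have "\<dots> < c * real n"
        using n n0 c npos by (intro sqrt_linear_less) auto
      finally show "real (card F) * real (q\<^sup>2 - 1) / real q ^ 4
          + sqrt (2 * real (Suc q * q) * real D * real (card F)) < real (card E)"
        using 1 E by linarith
    qed
    then show False using G(3) by contradiction
  qed
  then show ?thesis by blast
qed

text \<open>\<open>C\<close> is quantified before \<open>\<beta>\<close>, while the threshold for
  \<open>n\<close> may depend on \<open>\<beta>\<close>. The alternative \<open>r - 2 = 1\<close>
  admits \<open>1 = p ^ 0\<close> as a prime power, which \<open>primepow\<close> excludes.\<close>

theorem theorem1:
  fixes r :: nat and d :: real
  assumes "r \<ge> 3" and "r - 2 = 1 \<or> primepow (r - 2)" and "d > 0"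
  shows "\<exists>C :: real. \<forall>\<beta> :: real. 0 < \<beta> \<and> \<beta> < 1 \<longrightarrow>
    (\<exists>n\<^sub>0. \<forall>n\<ge>n\<^sub>0. \<forall>(V :: nat set) E.
      fin_graph V E \<and> card V = n \<and> connected_graph V E \<and>
      average_degree V E \<ge> d \<and> real (independence_number V E) \<le> \<beta> * real n \<longrightarrow>
      real (size_ramsey V E r) > real n * d / 2 * (real r - 2)\<^sup>2 - C * sqrt (real n))"
proof (rule exI[of _ 1], intro allI impI)
  fix \<beta> :: real assume \<beta>: "0 < \<beta> \<and> \<beta> < 1"
  define q where "q = r - 2"
  have r: "r = q + 2" "real r - 2 = real q" using assms(1) by (auto simp: q_def)
  show "\<exists>n\<^sub>0. \<forall>n\<ge>n\<^sub>0. \<forall>(V :: nat set) E.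
      fin_graph V E \<and> card V = n \<and> connected_graph V E \<and>
      average_degree V E \<ge> d \<and> real (independence_number V E) \<le> \<beta> * real n \<longrightarrow>
      real (size_ramsey V E r) > real n * d / 2 * (real r - 2)\<^sup>2 - 1 * sqrt (real n)"
  proof (cases "q = 1")
    case True
    have "real (size_ramsey V E r) > real n * d / 2 * (real r - 2)\<^sup>2 - 1 * sqrt (real n)"
      if "n \<ge> 1" "fin_graph V E" "card V = n" "average_degree V E \<ge> d" for n and V :: "nat set" and E
    proof -
      have "real n * d / 2 \<le> real (card E)"
        using that by (simp add: average_degree_def field_simps)
      also have "\<dots> \<le> real (size_ramsey V E r)"
        using card_edges_le_size_ramsey[OF that(2), of r] assms(1) by simp
      finally have "real n * d / 2 * (real r - 2)\<^sup>2 \<le> real (size_ramsey V E r)"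
        using r(2) True by simp
      \<comment> \<open>Counting edges gives only a weak inequality for \<open>q = 1\<close>;
        subtracting the positive square root makes it strict.\<close>
      moreover have "sqrt (real n) > 0" using that(1) by simp
      ultimately show ?thesis by linarith
    qed
    then show ?thesis by blast
  next
    case False
    then obtain n0 where n0: "\<forall>n\<ge>n0. \<forall>(V :: nat set) E.
      fin_graph V E \<and> card V = n \<and> connected_graph V E \<and>
      average_degree V E \<ge> d \<and> real (independence_number V E) \<le> \<beta> * real n \<longrightarrow>
      real (size_ramsey V E (q + 2)) > real n * d / 2 * (real q)\<^sup>2"
      using size_ramsey_gt[of q d \<beta>] assms \<beta> q_def by auto
    show ?thesis
    proof (intro exI[of _ n0] allI impI)
      fix n and V :: "nat set" and E
      assume "n \<ge> n0" "fin_graph V E \<and> card V = n \<and> connected_graph V E \<and>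
        average_degree V E \<ge> d \<and> real (independence_number V E) \<le> \<beta> * real n"
      then have "real (size_ramsey V E (q + 2)) > real n * d / 2 * (real q)\<^sup>2"
        using n0 by blast
      moreover have "0 \<le> sqrt (real n)" by simp
      ultimately show "real (size_ramsey V E r) > real n * d / 2 * (real r - 2)\<^sup>2 - 1 * sqrt (real n)"
        unfolding r(2) unfolding r(1) by linarith
    qed
  qed
qed

end
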